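(* Let $M$ be a representation in $\mathrm{rep}(A)$. Then $F(M)$ is $\theta$-stable if and only if $M$ is simple.
   Context: $\mathbb{K}$ is an algebraically closed field, $m\ge 1$, and $A=A_1*\cdots*A_m$ is the free product (coproduct in associative unital $\mathbb{K}$-algebras) of finite dimensional semisimple $\mathbb{K}$-algebras $A_i$, none of which is one-dimensional. Write $A_i=A_{i1}\times\cdots\times A_{ir_i}$ with $A_{ij}=\mathrm{Mat}_{w_{ij}}(\mathbb{K})$, and let $e_{ij}^{pq}\in A_{ij}$ be the matrix units. $\mathrm{rep}(A)$ is the category of finite dimensional left $A$-modules. The quiver $\Gamma=\Gamma_A$ has one sink $v_0$, a source $v_{ij}$ for each $1\le i\le m$, $1\le j\le r_i$, and $w_{ij}$ arrows $\alpha_{ij}^1,\dots,\alpha_{ij}^{w_{ij}}$ from $v_{ij}$ to $v_0$. $\mathrm{rep}(\Gamma)$ is the category of finite dimensional representations of $\Gamma$ over $\mathbb{K}$. The functor $F:\mathrm{rep}(A)\to\mathrm{rep}(\Gamma)$ sends $M$ to the representation with $F(M)(v_0)=M$, $F(M)(v_{ij})=e_{ij}^{11}M$, and $F(M)(\alpha_{ij}^k):e_{ij}^{11}M\to M$ equal to left multiplication by $e_{ij}^{k1}$; it sends $f$ to $f$ at $v_0$ and to the restrictions of $f$ at the $v_{ij}$. The stability parameter $\theta\in\mathbb{Z}^{\Gamma_0}$ has $\theta_{v_0}=-m$ and $\theta_{v_{ij}}=w_{ij}$, and for a dimension vector $d$ we put $\theta(d)=\sum_{v}\theta_vd_v$.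 A nonzero representation $X$ of $\Gamma$ is $\theta$-stable if $\theta(\dim X)=0$ and $\theta(\dim X')<0$ for every proper nonzero subrepresentation $X'$ of $X$. *)

theory Defs
  imports
    "Jordan_Normal_Form.VS_Connect"
    "HOL-Algebra.QuotRing"
    "HOL-Library.Poly_Mapping"
    "Graph_Theory.Digraph"
begin

hide_const (open) Modules.module_hom Real_Vector_Spaces.subspace

text \<open>
  The ground field is a type \<open>'k\<close>, seen as a ring record through \<open>class_ring\<close>. Algebras and vector
  spaces over it are \<open>('k, 'a) module\<close> records; for a bare vector space the multiplicative fields
  of the record play no role. All families are indexed from \<open>0\<close>, so that
  \<open>e\<^bsub>ij\<^esub>\<^bsup>11\<^esup>\<close> is the matrix unit with upper indices \<open>0 0\<close>.
\<close>


section \<open>Algebras\<close>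

locale k_algebra = Module.module "class_ring :: 'k ring" A + ring A
  for A :: "('k::field, 'a) module" (structure) +
  assumes smult_mult_left: "\<lbrakk>x \<in> carrier A; y \<in> carrier A\<rbrakk> \<Longrightarrow> (c \<odot> x) \<otimes> y = c \<odot> (x \<otimes> y)"
    and smult_mult_right: "\<lbrakk>x \<in> carrier A; y \<in> carrier A\<rbrakk> \<Longrightarrow> x \<otimes> (c \<odot> y) = c \<odot> (x \<otimes> y)"

definition algebra_iso :: "('k::field, 'a) module \<Rightarrow> ('k, 'b) module \<Rightarrow> ('a \<Rightarrow> 'b) set" where
  "algebra_iso A B = ring_iso A B \<inter> module_hom class_ring A B"

definition product_algebra :: "'i set \<Rightarrow> ('i \<Rightarrow> ('k, 'a) module) \<Rightarrow> ('k, 'i \<Rightarrow> 'a) module" where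
  "product_algebra I B =
    \<lparr>carrier = (\<Pi>\<^sub>E j\<in>I. carrier (B j)),
     mult = (\<lambda>x y. \<lambda>j\<in>I. x j \<otimes>\<^bsub>B j\<^esub> y j),
     one = (\<lambda>j\<in>I. \<one>\<^bsub>B j\<^esub>),
     zero = (\<lambda>j\<in>I. \<zero>\<^bsub>B j\<^esub>),
     add = (\<lambda>x y. \<lambda>j\<in>I. x j \<oplus>\<^bsub>B j\<^esub> y j),
     smult = (\<lambda>c x. \<lambda>j\<in>I. c \<odot>\<^bsub>B j\<^esub> x j)\<rparr>"

text \<open>\<open>Mat\<^bsub>w 0\<^esub>(K) \<times> \<dots> \<times> Mat\<^bsub>w (r - 1)\<^esub>(K)\<close>\<close>

definition matrix_product_algebra :: "nat \<Rightarrow> (nat \<Rightarrow> nat) \<Rightarrow> ('k::field, nat \<Rightarrow> 'k mat) module" where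
  "matrix_product_algebra r w = product_algebra {..<r} (\<lambda>j. module_mat TYPE('k) (w j) (w j))"

definition matrix_product_unit ::
    "nat \<Rightarrow> (nat \<Rightarrow> nat) \<Rightarrow> nat \<Rightarrow> nat \<Rightarrow> nat \<Rightarrow> nat \<Rightarrow> 'k::field mat" where
  "matrix_product_unit r w j p q =
    (\<lambda>j'\<in>{..<r}. mat (w j') (w j') (\<lambda>(a, b). if j' = j \<and> a = p \<and> b = q then 1 else 0))"


section \<open>Modules over an algebra\<close>

text \<open>A left \<open>A\<close>-module is a vector space \<open>V\<close> with an action \<open>\<rho>\<close> of \<open>A\<close> by linear endomorphisms.
  (The locale \<open>module\<close> of the library requires a commutative ring.)\<close>

locale left_module = k_algebra A + vectorspace "class_ring :: 'k ring" V
  for A :: "('k::field, 'a) module" and V :: "('k, 'v) module" and \<rho> :: "'a \<Rightarrow> 'v \<Rightarrow> 'v" +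
  assumes act_linear: "a \<in> carrier A \<Longrightarrow> \<rho> a \<in> module_hom class_ring V V"
    and act_add: "\<lbrakk>a \<in> carrier A; b \<in> carrier A; v \<in> carrier V\<rbrakk>
      \<Longrightarrow> \<rho> (a \<oplus>\<^bsub>A\<^esub> b) v = \<rho> a v \<oplus>\<^bsub>V\<^esub> \<rho> b v"
    and act_smult: "\<lbrakk>a \<in> carrier A; v \<in> carrier V\<rbrakk> \<Longrightarrow> \<rho> (c \<odot>\<^bsub>A\<^esub> a) v = c \<odot>\<^bsub>V\<^esub> \<rho> a v"
    and act_mult: "\<lbrakk>a \<in> carrier A; b \<in> carrier A; v \<in> carrier V\<rbrakk>
      \<Longrightarrow> \<rho> (a \<otimes>\<^bsub>A\<^esub> b) v = \<rho> a (\<rho> b v)"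
    and act_one: "v \<in> carrier V \<Longrightarrow> \<rho> \<one>\<^bsub>A\<^esub> v = v"

definition in_rep :: "('k::field, 'a) module \<Rightarrow> ('k, 'v) module \<Rightarrow> ('a \<Rightarrow> 'v \<Rightarrow> 'v) \<Rightarrow> bool" where
  "in_rep A V \<rho> \<longleftrightarrow> left_module A V \<rho> \<and> vectorspace.fin_dim class_ring V"

definition left_submodule ::
    "('k::field, 'a) module \<Rightarrow> ('k, 'v) module \<Rightarrow> ('a \<Rightarrow> 'v \<Rightarrow> 'v) \<Rightarrow> 'v set \<Rightarrow> bool" where
  "left_submodule A V \<rho> N \<longleftrightarrow>
    subspace class_ring N V \<and> (\<forall>a\<in>carrier A. \<forall>v\<in>N. \<rho> a v \<in> N)"

definition simple_module ::
    "('k::field, 'a) module \<Rightarrow> ('k, 'v) module \<Rightarrow> ('a \<Rightarrow> 'v \<Rightarrow> 'v) \<Rightarrow> bool" where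
  "simple_module A V \<rho> \<longleftrightarrow>
    carrier V \<noteq> {\<zero>\<^bsub>V\<^esub>} \<and>
    (\<forall>N. left_submodule A V \<rho> N \<longrightarrow> N = {\<zero>\<^bsub>V\<^esub>} \<or> N = carrier V)"

definition semisimple_module ::
    "('k::field, 'a) module \<Rightarrow> ('k, 'v) module \<Rightarrow> ('a \<Rightarrow> 'v \<Rightarrow> 'v) \<Rightarrow> bool" where
  "semisimple_module A V \<rho> \<longleftrightarrow>
    (\<forall>N. left_submodule A V \<rho> N \<longrightarrow>
      (\<exists>N'. left_submodule A V \<rho> N' \<and> N \<inter> N' = {\<zero>\<^bsub>V\<^esub>} \<and> N <+>\<^bsub>V\<^esub> N' = carrier V))"

definition semisimple_algebra :: "('k::field, 'a) module \<Rightarrow> bool" where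
  "semisimple_algebra A \<longleftrightarrow> semisimple_module A A (mult A)"


section \<open>Free products of algebras\<close>

datatype 'x free_monoid = Word (letters: "'x list")

instantiation free_monoid :: (type) monoid_add
begin

definition "0 = Word []"

definition "u + v = Word (letters u @ letters v)"

instance
  by standard (simp_all add: zero_free_monoid_def plus_free_monoid_def)

end

text \<open>The library's product on \<open>\<Rightarrow>\<^sub>0\<close> is convolution along the addition of the index type. Here
  this addition is concatenation of words, which yields noncommutative polynomials.\<close>

definition free_algebra :: "'x set \<Rightarrow> ('k::field, 'x free_monoid \<Rightarrow>\<^sub>0 'k) module" where
  "free_algebra X =
    \<lparr>carrier = {f. \<forall>u\<in>Poly_Mapping.keys f. set (letters u) \<subseteq> X},
     mult = (*), one = 1, zero = 0, add = (+),
     smult = (\<lambda>c f. Poly_Mapping.single 0 c * f)\<rparr>"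

definition gen :: "'x \<Rightarrow> 'x free_monoid \<Rightarrow>\<^sub>0 'k::field" where
  "gen x = Poly_Mapping.single (Word [x]) 1"

text \<open>The coproduct of the algebras \<open>B i\<close> is the free algebra on the disjoint union of their underlying
  sets, modulo the relations that make each map \<open>B i \<rightarrow> free_product I B\<close> a unital algebra
  homomorphism.\<close>

definition free_product_gens :: "'i set \<Rightarrow> ('i \<Rightarrow> ('k::field, 'b) module) \<Rightarrow> ('i \<times> 'b) set" where
  "free_product_gens I B = (SIGMA i:I. carrier (B i))"

definition free_product_rels ::
    "'i set \<Rightarrow> ('i \<Rightarrow> ('k::field, 'b) module) \<Rightarrow> (('i \<times> 'b) free_monoid \<Rightarrow>\<^sub>0 'k) set" where
  "free_product_rels I B =
    {gen (i, x \<oplus>\<^bsub>B i\<^esub> y) - (gen (i, x) + gen (i, y)) | i x y.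
       i \<in> I \<and> x \<in> carrier (B i) \<and> y \<in> carrier (B i)} \<union>
    {gen (i, c \<odot>\<^bsub>B i\<^esub> x) - Poly_Mapping.single 0 c * gen (i, x) | i c x.
       i \<in> I \<and> x \<in> carrier (B i)} \<union>
    {gen (i, x \<otimes>\<^bsub>B i\<^esub> y) - gen (i, x) * gen (i, y) | i x y.
       i \<in> I \<and> x \<in> carrier (B i) \<and> y \<in> carrier (B i)} \<union>
    {gen (i, \<one>\<^bsub>B i\<^esub>) - 1 | i. i \<in> I}"

definition free_product_ideal ::
    "'i set \<Rightarrow> ('i \<Rightarrow> ('k::field, 'b) module) \<Rightarrow> (('i \<times> 'b) free_monoid \<Rightarrow>\<^sub>0 'k) set" where
  "free_product_ideal I B = Idl\<^bsub>free_algebra (free_product_gens I B)\<^esub> (free_product_rels I B)"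

definition free_product_class ::
    "'i set \<Rightarrow> ('i \<Rightarrow> ('k::field, 'b) module) \<Rightarrow>
     (('i \<times> 'b) free_monoid \<Rightarrow>\<^sub>0 'k) \<Rightarrow> (('i \<times> 'b) free_monoid \<Rightarrow>\<^sub>0 'k) set" where
  "free_product_class I B f =
    free_product_ideal I B +>\<^bsub>free_algebra (free_product_gens I B)\<^esub> f"

definition free_product ::
    "'i set \<Rightarrow> ('i \<Rightarrow> ('k::field, 'b) module) \<Rightarrow>
     ('k, (('i \<times> 'b) free_monoid \<Rightarrow>\<^sub>0 'k) set) module" where
  "free_product I B =
    (let Q = free_algebra (free_product_gens I B) Quot free_product_ideal I B
     in \<lparr>carrier = carrier Q, mult = mult Q, one = one Q, zero = zero Q, add = add Q,
         smult = (\<lambda>c a. free_product_class I B (Poly_Mapping.single 0 c) \<otimes>\<^bsub>Q\<^esub> a)\<rparr>)"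

definition free_product_inj ::
    "'i set \<Rightarrow> ('i \<Rightarrow> ('k::field, 'b) module) \<Rightarrow> 'i \<Rightarrow> 'b \<Rightarrow>
     (('i \<times> 'b) free_monoid \<Rightarrow>\<^sub>0 'k) set" where
  "free_product_inj I B i x = free_product_class I B (gen (i, x))"


text \<open>The free product is again an algebra, and the canonical maps into it are homomorphisms.\<close>

lemma free_algebra_simps [simp]:
  "carrier (free_algebra X) = {f. \<forall>u\<in>Poly_Mapping.keys f. set (letters u) \<subseteq> X}"
  "mult (free_algebra X) = (*)" "one (free_algebra X) = 1" "zero (free_algebra X) = 0"
  "add (free_algebra X) = (+)"
  "smult (free_algebra X) = (\<lambda>c f. Poly_Mapping.single 0 c * f)"
  by (simp_all add: free_algebra_def)

lemma free_monoid_letters_simps [simp]: "letters 0 = []" "letters (u + v) = letters u @ letters v"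
  by (simp_all add: zero_free_monoid_def plus_free_monoid_def)

lemma single_0_commute:
  fixes f :: "'x free_monoid \<Rightarrow>\<^sub>0 'k::field"
  shows "Poly_Mapping.single 0 c * f = f * Poly_Mapping.single 0 c"
proof (induction f rule: update_induct)
  case const
  then show ?case by simp
next
  case (update f k v)
  have "Poly_Mapping.update k v f = Poly_Mapping.single k v + f"
    using update.hyps(1)
    by (intro poly_mapping_eqI)
      (auto simp: lookup_update lookup_add lookup_single when_def in_keys_iff)
  then show ?case
    using update.IH by (simp add: distrib_left distrib_right mult_single mult.commute)
qed

lemma free_algebra_mult_closed:
  "f \<in> carrier (free_algebra X) \<Longrightarrow> g \<in> carrier (free_algebra X) \<Longrightarrow> f * g \<in> carrier (free_algebra X)"
  using keys_mult[of f g] by fastforce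

lemma free_algebra_add_closed:
  "f \<in> carrier (free_algebra X) \<Longrightarrow> g \<in> carrier (free_algebra X) \<Longrightarrow> f + g \<in> carrier (free_algebra X)"
  using Poly_Mapping.keys_add[of f g] by fastforce

lemma free_algebra_minus_closed:
  "f \<in> carrier (free_algebra X) \<Longrightarrow> - f \<in> carrier (free_algebra X)"
  by simp

lemma free_algebra_scalar_closed: "Poly_Mapping.single 0 c \<in> carrier (free_algebra X)"
  by simp

lemma ring_free_algebra: "ring (free_algebra X :: ('k::field, 'x free_monoid \<Rightarrow>\<^sub>0 'k) module)"
  (is "ring ?F")
proof (rule ringI)
  show "abelian_group ?F"
  proof (rule abelian_groupI)
    fix f assume "f \<in> carrier ?F"
    then show "\<exists>g\<in>carrier ?F. g \<oplus>\<^bsub>?F\<^esub> f = \<zero>\<^bsub>?F\<^esub>"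
      by (intro bexI[of _ "- f"]) auto
  next
    fix f g assume "f \<in> carrier ?F" "g \<in> carrier ?F"
    then show "f \<oplus>\<^bsub>?F\<^esub> g \<in> carrier ?F"
      using free_algebra_add_closed[of f X g] by simp
  qed (auto simp: add_ac)
  show "Group.monoid ?F"
  proof (rule monoidI)
    fix f g assume "f \<in> carrier ?F" "g \<in> carrier ?F"
    then show "f \<otimes>\<^bsub>?F\<^esub> g \<in> carrier ?F"
      using free_algebra_mult_closed[of f X g] by simp
  qed (auto simp: mult.assoc)
qed (auto simp: distrib_left distrib_right)

lemma free_algebra_gen_closed: "x \<in> X \<Longrightarrow> gen x \<in> carrier (free_algebra X)"
  by (simp add: gen_def)

lemma free_algebra_diff_closed:
  "f \<in> carrier (free_algebra X) \<Longrightarrow> g \<in> carrier (free_algebra X) \<Longrightarrow> f - g \<in> carrier (free_algebra X)"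
  using free_algebra_add_closed[of f X "- g"] free_algebra_minus_closed[of g X] by simp

lemma free_algebra_one_closed: "1 \<in> carrier (free_algebra X)" by simp

lemma free_product_rels_carrier:
  assumes "\<And>i. i \<in> I \<Longrightarrow> k_algebra (B i)"
  shows "free_product_rels I B \<subseteq> carrier (free_algebra (free_product_gens I B))"
proof -
  let ?F = "free_algebra (free_product_gens I B)"
  have g: "gen (i, x) \<in> carrier ?F" if "i \<in> I" "x \<in> carrier (B i)" for i x
    using that by (intro free_algebra_gen_closed) (simp add: free_product_gens_def)
  show ?thesis
    unfolding free_product_rels_def
  proof (intro Un_least subsetI; clarify)
    fix i x y assume h: "i \<in> I" "x \<in> carrier (B i)" "y \<in> carrier (B i)"
    then interpret k_algebra "B i" using assms by auto
    show "gen (i, x \<oplus>\<^bsub>B i\<^esub> y) - (gen (i, x) + gen (i, y)) \<in> carrier ?F"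
      using h by (intro free_algebra_diff_closed free_algebra_add_closed g) auto
    show "gen (i, x \<otimes>\<^bsub>B i\<^esub> y) - gen (i, x) * gen (i, y) \<in> carrier ?F"
      using h by (intro free_algebra_diff_closed free_algebra_mult_closed g) auto
  next
    fix i c x assume h: "i \<in> I" "x \<in> carrier (B i)"
    then interpret k_algebra "B i" using assms by auto
    have "c \<odot>\<^bsub>B i\<^esub> x \<in> carrier (B i)" using h by (intro smult_closed) (auto simp: class_ring_simps)
    then show "gen (i, c \<odot>\<^bsub>B i\<^esub> x) - Poly_Mapping.single 0 c * gen (i, x) \<in> carrier ?F"
      using h by (intro free_algebra_diff_closed free_algebra_mult_closed free_algebra_scalar_closed g)
  next
    fix i assume h: "i \<in> I"
    then interpret k_algebra "B i" using assms by auto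
    show "gen (i, \<one>\<^bsub>B i\<^esub>) - 1 \<in> carrier ?F"
      using h by (intro free_algebra_diff_closed free_algebra_one_closed g) auto
  qed
qed

context
  fixes I :: "'i set" and B :: "'i \<Rightarrow> ('k::field, 'b) module"
  assumes B: "\<And>i. i \<in> I \<Longrightarrow> k_algebra (B i)"
begin

private abbreviation (input) FF :: "('k, ('i \<times> 'b) free_monoid \<Rightarrow>\<^sub>0 'k) module"
  where "FF \<equiv> free_algebra (free_product_gens I B)"
private abbreviation (input) J where "J \<equiv> free_product_ideal I B"
private abbreviation (input) cl where "cl \<equiv> free_product_class I B"
private abbreviation (input) P where "P \<equiv> free_product I B"

lemma ideal_free_product_ideal: "ideal J FF"
  unfolding free_product_ideal_def
  by (rule ring.genideal_ideal[OF ring_free_algebra free_product_rels_carrier[OF B]])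

lemma free_product_carrier: "carrier P = cl ` carrier FF"
  unfolding free_product_def free_product_class_def Let_def FactRing_def A_RCOSETS_def'
  by auto

lemma free_product_ops:
  assumes "f \<in> carrier FF" "g \<in> carrier FF"
  shows "cl f \<otimes>\<^bsub>P\<^esub> cl g = cl (f * g)" "cl f \<oplus>\<^bsub>P\<^esub> cl g = cl (f + g)"
    "c \<odot>\<^bsub>P\<^esub> cl f = cl (Poly_Mapping.single 0 c * f)"
proof -
  show "cl f \<otimes>\<^bsub>P\<^esub> cl g = cl (f * g)"
    using ideal.rcoset_mult_add[OF ideal_free_product_ideal assms]
    by (simp add: free_product_def free_product_class_def Let_def FactRing_def)
  show "cl f \<oplus>\<^bsub>P\<^esub> cl g = cl (f + g)"
    using abelian_subgroup.a_rcos_sum[OF abelian_subgroupI3[OF ideal.axioms(1)[OF ideal_free_product_ideal]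
          ring.is_abelian_group[OF ring_free_algebra]] assms]
    by (simp add: free_product_def free_product_class_def Let_def FactRing_def)
  show "c \<odot>\<^bsub>P\<^esub> cl f = cl (Poly_Mapping.single 0 c * f)"
    using ideal.rcoset_mult_add[OF ideal_free_product_ideal free_algebra_scalar_closed assms(1)]
    by (simp add: free_product_def free_product_class_def Let_def FactRing_def)
qed

lemma free_product_one_zero: "\<one>\<^bsub>P\<^esub> = cl 1" "\<zero>\<^bsub>P\<^esub> = cl 0"
  using ring.ring_simprules(2)[OF ring_free_algebra]
    ideal.axioms(1)[OF ideal_free_product_ideal]
   apply (simp_all add: free_product_def free_product_class_def Let_def FactRing_def)
  by (metis abelian_group.a_coset_add_zero additive_subgroup.a_subset free_algebra_simps(4)
      ideal_free_product_ideal ideal_def ring.is_abelian_group ring_free_algebra)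

lemma ring_free_product: "ring P"
proof -
  interpret Q: ring "FF Quot J" by (rule ideal.quotient_is_ring[OF ideal_free_product_ideal])
  have s: "carrier P = carrier (FF Quot J)" "mult P = mult (FF Quot J)" "one P = one (FF Quot J)"
    "zero P = zero (FF Quot J)" "add P = add (FF Quot J)"
    by (simp_all add: free_product_def Let_def)
  show ?thesis
  proof (rule ringI)
    show "abelian_group P"
      by (rule abelian_groupI) (use Q.l_neg in \<open>auto simp: s Q.a_ac intro: Q.add.inv_closed\<close>)
    show "Group.monoid P" by (rule monoidI) (auto simp: s Q.m_assoc)
  qed (auto simp: s Q.l_distr Q.r_distr)
qed

lemma k_algebra_free_product: "k_algebra P"
proof -
  have F: "f \<in> carrier FF \<Longrightarrow> Poly_Mapping.single 0 c * f \<in> carrier FF" for f c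
    by (rule free_algebra_mult_closed[OF free_algebra_scalar_closed])
  note cls = F free_algebra_mult_closed free_algebra_add_closed
  interpret ring P by (rule ring_free_product)
  interpret FF: ring FF by (rule ring_free_algebra)
  have "Module.module class_ring P"
  proof (rule moduleI)
    show "cring (class_ring :: 'k ring)" ..
  qed (auto simp: free_product_carrier free_product_ops cls class_ring_simps single_add
      distrib_left distrib_right mult_single mult.assoc[symmetric]
      simp del: free_algebra_simps(1) intro: ring.is_abelian_group ring_free_product)
  moreover have "f * (Poly_Mapping.single 0 c * g) = Poly_Mapping.single 0 c * (f * g)"
    for c :: 'k and f g :: "('i \<times> 'b) free_monoid \<Rightarrow>\<^sub>0 'k"
    by (metis mult.assoc single_0_commute)
  ultimately show ?thesis
    by (intro k_algebra.intro ring_free_product k_algebra_axioms.intro)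
      (auto simp: free_product_carrier free_product_ops cls mult.assoc simp del: free_algebra_simps(1))
qed

lemma free_product_class_eqI:
  assumes "f \<in> carrier FF" "g \<in> carrier FF" "f - g \<in> J"
  shows "cl f = cl g"
proof -
  interpret ring FF by (rule ring_free_algebra)
  have "f \<ominus>\<^bsub>FF\<^esub> g \<in> J"
  proof -
    have "\<ominus>\<^bsub>FF\<^esub> g = - g"
      by (rule minus_equality) (use assms(2) in auto)
    then show ?thesis using assms(3) by (simp add: a_minus_def)
  qed
  then show ?thesis
    unfolding free_product_class_def
    using quotient_eq_iff_same_a_r_cos[OF ideal_free_product_ideal assms(1,2)] by simp
qed

lemma free_product_class_rel: "f \<in> carrier FF \<Longrightarrow> g \<in> carrier FF \<Longrightarrow> f - g \<in> free_product_rels I B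
    \<Longrightarrow> cl f = cl g"
  by (rule free_product_class_eqI) (auto simp: free_product_ideal_def genideal_def)

lemma free_product_inj_hom:
  assumes i: "i \<in> I"
  shows "free_product_inj I B i \<in> Ring.ring_hom (B i) P \<inter> module_hom class_ring (B i) P"
proof -
  interpret k_algebra "B i" by (rule B[OF i])
  have g: "gen (i, x) \<in> carrier FF" if "x \<in> carrier (B i)" for x
    using that i by (intro free_algebra_gen_closed) (simp add: free_product_gens_def)
  have sm: "c \<odot>\<^bsub>B i\<^esub> x \<in> carrier (B i)" if "x \<in> carrier (B i)" for c x
    using that by (intro smult_closed) (auto simp: class_ring_simps)
  note cls = g sm free_algebra_mult_closed free_algebra_add_closed free_algebra_scalar_closed free_algebra_one_closed
  have a: "cl (gen (i, x \<oplus>\<^bsub>B i\<^esub> y)) = cl (gen (i, x) + gen (i, y))"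
    and m: "cl (gen (i, x \<otimes>\<^bsub>B i\<^esub> y)) = cl (gen (i, x) * gen (i, y))"
    if "x \<in> carrier (B i)" "y \<in> carrier (B i)" for x y
    by (rule free_product_class_rel; use that i in \<open>auto intro!: cls simp: free_product_rels_def simp del: free_algebra_simps(1)\<close>)+
  have s: "cl (gen (i, c \<odot>\<^bsub>B i\<^esub> x)) = cl (Poly_Mapping.single 0 c * gen (i, x))"
    if "x \<in> carrier (B i)" for c x
    by (rule free_product_class_rel; use that i in \<open>auto intro!: cls simp: free_product_rels_def simp del: free_algebra_simps(1)\<close>)
  have o: "cl (gen (i, \<one>\<^bsub>B i\<^esub>)) = cl 1"
    using i by (intro free_product_class_rel g free_algebra_one_closed) (auto simp: free_product_rels_def)
  show ?thesis
    by (auto simp: Ring.ring_hom_def LinearCombinations.module_hom_def free_product_inj_def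
        free_product_carrier free_product_ops free_product_ops(3)[OF g g] free_product_one_zero a m s o g
        simp del: free_algebra_simps(1))
qed
end


section \<open>Quiver representations and stability\<close>

text \<open>A quiver is a \<open>pre_digraph\<close>, which allows multiple arrows. A representation consists of a vector
  space for each vertex and a map for each arrow; values outside the quiver are irrelevant.\<close>

record ('k, 'x, 'e, 'v) qrep =
  vspace :: "'x \<Rightarrow> ('k, 'v) module"
  vmap :: "'e \<Rightarrow> 'v \<Rightarrow> 'v"

definition quiver_rep :: "('x, 'e) pre_digraph \<Rightarrow> ('k::field, 'x, 'e, 'v) qrep \<Rightarrow> bool" where
  "quiver_rep Q X \<longleftrightarrow>
    (\<forall>x\<in>verts Q. vectorspace class_ring (vspace X x) \<and>
       vectorspace.fin_dim class_ring (vspace X x)) \<and>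
    (\<forall>e\<in>arcs Q. linear_map class_ring (vspace X (tail Q e)) (vspace X (head Q e)) (vmap X e))"

definition subrep ::
    "('x, 'e) pre_digraph \<Rightarrow> ('k::field, 'x, 'e, 'v) qrep \<Rightarrow> ('x \<Rightarrow> 'v set) \<Rightarrow> bool" where
  "subrep Q X S \<longleftrightarrow>
    (\<forall>x\<in>verts Q. subspace class_ring (S x) (vspace X x)) \<and>
    (\<forall>e\<in>arcs Q. \<forall>v\<in>S (tail Q e). vmap X e v \<in> S (head Q e))"

definition restrict_rep ::
    "('k, 'x, 'e, 'v) qrep \<Rightarrow> ('x \<Rightarrow> 'v set) \<Rightarrow> ('k, 'x, 'e, 'v) qrep" where
  "restrict_rep X S = X\<lparr>vspace := (\<lambda>x. (vspace X x)\<lparr>carrier := S x\<rparr>)\<rparr>"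

definition nonzero_rep :: "('x, 'e) pre_digraph \<Rightarrow> ('k, 'x, 'e, 'v) qrep \<Rightarrow> bool" where
  "nonzero_rep Q X \<longleftrightarrow> (\<exists>x\<in>verts Q. carrier (vspace X x) \<noteq> {\<zero>\<^bsub>vspace X x\<^esub>})"

definition proper_subrep ::
    "('x, 'e) pre_digraph \<Rightarrow> ('k::field, 'x, 'e, 'v) qrep \<Rightarrow> ('x \<Rightarrow> 'v set) \<Rightarrow> bool" where
  "proper_subrep Q X S \<longleftrightarrow> subrep Q X S \<and> (\<exists>x\<in>verts Q. S x \<noteq> carrier (vspace X x))"

definition dim_vector :: "('k::field, 'x, 'e, 'v) qrep \<Rightarrow> 'x \<Rightarrow> nat" where
  "dim_vector X x = vectorspace.dim class_ring (vspace X x)"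

definition weight :: "('x, 'e) pre_digraph \<Rightarrow> ('x \<Rightarrow> int) \<Rightarrow> ('x \<Rightarrow> nat) \<Rightarrow> int" where
  "weight Q \<theta> d = (\<Sum>x\<in>verts Q. \<theta> x * int (d x))"

definition theta_stable ::
    "('x, 'e) pre_digraph \<Rightarrow> ('x \<Rightarrow> int) \<Rightarrow> ('k::field, 'x, 'e, 'v) qrep \<Rightarrow> bool" where
  "theta_stable Q \<theta> X \<longleftrightarrow>
    quiver_rep Q X \<and> nonzero_rep Q X \<and> weight Q \<theta> (dim_vector X) = 0 \<and>
    (\<forall>S. proper_subrep Q X S \<and> nonzero_rep Q (restrict_rep X S) \<longrightarrow>
       weight Q \<theta> (dim_vector (restrict_rep X S)) < 0)"


section \<open>The quiver of a free product and the functor \<open>F\<close>\<close>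

datatype vertex = Sink | Source nat nat

text \<open>The arrow \<open>\<alpha>\<^bsub>ij\<^esub>\<^bsup>k\<^esup>\<close> is the triple \<open>(i, j, k)\<close>.\<close>

definition Gamma ::
    "nat \<Rightarrow> (nat \<Rightarrow> nat) \<Rightarrow> (nat \<Rightarrow> nat \<Rightarrow> nat) \<Rightarrow> (vertex, nat \<times> nat \<times> nat) pre_digraph" where
  "Gamma m r w =
    \<lparr>verts = {Sink} \<union> {Source i j | i j. i < m \<and> j < r i},
     arcs = {(i, j, k). i < m \<and> j < r i \<and> k < w i j},
     tail = (\<lambda>(i, j, k). Source i j),
     head = (\<lambda>(i, j, k). Sink)\<rparr>"

fun theta :: "nat \<Rightarrow> (nat \<Rightarrow> nat \<Rightarrow> nat) \<Rightarrow> vertex \<Rightarrow> int" where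
  "theta m w Sink = - int m"
| "theta m w (Source i j) = int (w i j)"

text \<open>\<open>F\<close> on objects. The argument \<open>e i j p q\<close> is the matrix unit \<open>e\<^bsub>ij\<^esub>\<^bsup>pq\<^esup>\<close> in \<open>A\<close>, and \<open>\<rho>\<close> is the
  action on \<open>M\<close>.\<close>

definition F_obj ::
    "(nat \<Rightarrow> nat \<Rightarrow> nat \<Rightarrow> nat \<Rightarrow> 'a) \<Rightarrow> ('k::field, 'v) module \<Rightarrow> ('a \<Rightarrow> 'v \<Rightarrow> 'v) \<Rightarrow>
     ('k, vertex, nat \<times> nat \<times> nat, 'v) qrep" where
  "F_obj e M \<rho> =
    \<lparr>vspace = (\<lambda>x. case x of
         Sink \<Rightarrow> M
       | Source i j \<Rightarrow> M\<lparr>carrier := \<rho> (e i j 0 0) ` carrier M\<rparr>),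
     vmap = (\<lambda>(i, j, k). \<rho> (e i j k 0))\<rparr>"

text \<open>The matrix units of \<open>A = A\<^sub>0 * \<dots> * A\<^bsub>m-1\<^esub>\<close>, where \<open>\<phi> i\<close> identifies
  \<open>Mat\<^bsub>w i 0\<^esub>(K) \<times> \<dots> \<times> Mat\<^bsub>w i (r i - 1)\<^esub>(K)\<close> with \<open>A\<^sub>i\<close>.\<close>

definition matrix_unit ::
    "nat \<Rightarrow> (nat \<Rightarrow> ('k::field, 'b) module) \<Rightarrow> (nat \<Rightarrow> nat) \<Rightarrow> (nat \<Rightarrow> nat \<Rightarrow> nat) \<Rightarrow>
     (nat \<Rightarrow> (nat \<Rightarrow> 'k mat) \<Rightarrow> 'b) \<Rightarrow> nat \<Rightarrow> nat \<Rightarrow> nat \<Rightarrow> nat \<Rightarrow>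
     ((nat \<times> 'b) free_monoid \<Rightarrow>\<^sub>0 'k) set" where
  "matrix_unit m A r w \<phi> i j p q =
    free_product_inj {..<m} A i (\<phi> i (matrix_product_unit (r i) (w i) j p q))"

end

theory Submission
  imports Defs
begin

text \<open>
  Write \<open>e\<^bsub>ij\<^esub>\<^bsup>pq\<^esup>\<close> for the matrix units acting on \<open>M\<close>, counted from \<open>0\<close>, and let \<open>S\<close> be a
  subrepresentation of \<open>F(M)\<close> with sink part \<open>U\<close> and source parts \<open>S\<^bsub>ij\<^esub> \<subseteq> e\<^bsub>ij\<^esub>\<^bsup>00\<^esup>M\<close>. Its weight is
  the sum over \<open>i\<close> of the numbers \<open>\<Sum>\<^sub>j w\<^bsub>ij\<^esub> dim S\<^bsub>ij\<^esub> - dim U\<close>, so each factor of the free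
  product can be studied alone.

  Fix \<open>i\<close>. The spaces \<open>e\<^bsub>ij\<^esub>\<^bsup>k0\<^esup> S\<^bsub>ij\<^esub>\<close> lie in \<open>U\<close>, because \<open>S\<close> is closed under the arrows. They
  are independent, because the idempotents \<open>e\<^bsub>ij\<^esub>\<^bsup>kk\<^esup>\<close> separate them, and each has the dimension of
  \<open>S\<^bsub>ij\<^esub>\<close>, because \<open>e\<^bsub>ij\<^esub>\<^bsup>0k\<^esup>\<close> undoes \<open>e\<^bsub>ij\<^esub>\<^bsup>k0\<^esup>\<close> there. Hence they span a subspace of \<open>U\<close> of
  dimension \<open>\<Sum>\<^sub>j w\<^bsub>ij\<^esub> dim S\<^bsub>ij\<^esub>\<close> (\<open>dim_generated\<close>), and the weight of every
  subrepresentation is at most \<open>0\<close>. If it equals \<open>0\<close>, these spaces span \<open>U\<close> for every \<open>i\<close>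
  (\<open>subrep_weight\<close>). The span is closed under all \<open>e\<^bsub>ij\<^esub>\<^bsup>pq\<^esup>\<close> (\<open>generated_stable\<close>) and it
  determines \<open>S\<^bsub>ij\<^esub>\<close> as its part in \<open>e\<^bsub>ij\<^esub>\<^bsup>00\<^esup>M\<close> (\<open>corner_of_generated\<close>). Conversely a submodule
  \<open>N\<close> is spanned by the \<open>e\<^bsub>ij\<^esub>\<^bsup>k0\<^esup> e\<^bsub>ij\<^esub>\<^bsup>00\<^esup>N\<close>, because the idempotents sum to \<open>1\<close>; so \<open>F(N)\<close> has weight
  \<open>0\<close> (\<open>stable_weight\<close>).

  The subrepresentations of weight \<open>0\<close> are therefore the \<open>F(N)\<close> for submodules \<open>N\<close> of \<open>M\<close>. In
  particular \<open>F(M)\<close> itself has weight \<open>0\<close>, and a proper nonzero subrepresentation violating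
  stability is the same as a proper nonzero submodule (\<open>theta_stable_FM_iff\<close>).

  What remains is to see that closure under the matrix units is closure under the whole free
  product. A family of matrices is a linear combination of matrix units, and the
  elements of the free product are represented by linear combinations of words in the elements of
  the factors (\<open>submodule_iff_stable\<close>, \<open>left_submodule_free_product_iff\<close>).
\<close>

section \<open>Dimensions of subspaces\<close>

context vectorspace
begin

lemma subspace_intro:
  assumes "W \<subseteq> carrier V" "\<zero>\<^bsub>V\<^esub> \<in> W"
    and "\<And>v w. v \<in> W \<Longrightarrow> w \<in> W \<Longrightarrow> v \<oplus>\<^bsub>V\<^esub> w \<in> W"
    and "\<And>c v. c \<in> carrier K \<Longrightarrow> v \<in> W \<Longrightarrow> c \<odot>\<^bsub>V\<^esub> v \<in> W"
  shows "subspace K W V"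
  by (intro subspace.intro submodule.intro) (use assms in \<open>auto intro: vectorspace_axioms module_axioms\<close>)

lemma subspace_elim:
  assumes "subspace K W V"
  shows "W \<subseteq> carrier V" "\<zero>\<^bsub>V\<^esub> \<in> W"
    and "\<And>v w. v \<in> W \<Longrightarrow> w \<in> W \<Longrightarrow> v \<oplus>\<^bsub>V\<^esub> w \<in> W"
    and "\<And>c v. c \<in> carrier K \<Longrightarrow> v \<in> W \<Longrightarrow> c \<odot>\<^bsub>V\<^esub> v \<in> W"
  using assms by (auto simp: VectorSpace.subspace_def submodule_def)

lemma subspace_in_subspace_iff:
  assumes "subspace K U V"
  shows "subspace K W (vs U) \<longleftrightarrow> subspace K W V \<and> W \<subseteq> U"
proof -
  interpret U: vectorspace K "vs U" by (rule subspace_is_vs[OF assms])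
  show ?thesis
  proof
    assume "subspace K W (vs U)"
    note W = U.subspace_elim[OF this]
    have "subspace K W V"
      by (rule subspace_intro) (use W subspace_elim(1)[OF assms] in auto)
    then show "subspace K W V \<and> W \<subseteq> U" using W by simp
  next
    assume W: "subspace K W V \<and> W \<subseteq> U"
    note W' = subspace_elim[OF conjunct1[OF W]]
    show "subspace K W (vs U)" by (rule U.subspace_intro) (use W W' in simp_all)
  qed
qed

lemma carrier_is_subspace: "subspace K (carrier V) V"
  by (rule subspace_intro) auto

lemma zero_is_subspace: "subspace K {\<zero>\<^bsub>V\<^esub>} V"
  by (rule subspace_intro) auto

lemma hom_carrier: "f \<in> module_hom K V V \<Longrightarrow> v \<in> carrier V \<Longrightarrow> f v \<in> carrier V"
  by (auto simp: LinearCombinations.module_hom_def)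

lemma hom_zero: "f \<in> module_hom K V V \<Longrightarrow> f \<zero>\<^bsub>V\<^esub> = \<zero>\<^bsub>V\<^esub>"
  by (rule mod_hom.f0_is_0[OF mod_hom.intro]) (auto simp: mod_hom_axioms_def intro: module_axioms)

lemma linear_map_between_subspaces:
  assumes f: "f \<in> module_hom K V V" and "subspace K W V" "subspace K W' V" "f ` W \<subseteq> W'"
  shows "linear_map K (vs W) (vs W') f"
proof -
  interpret W: vectorspace K "vs W" by (rule subspace_is_vs) fact
  interpret W': vectorspace K "vs W'" by (rule subspace_is_vs) fact
  have "f \<in> module_hom K (vs W) (vs W')"
    using assms(4) subspace_elim(1)[OF assms(2)]
    by (auto simp: LinearCombinations.module_hom_def subset_iff LinearCombinations.module_hom_add[OF f] LinearCombinations.module_hom_smult[OF f])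
  then show ?thesis by unfold_locales
qed

lemma preimage_subspace:
  assumes f: "f \<in> module_hom K V V" and W: "subspace K W V"
  shows "subspace K {v \<in> carrier V. f v \<in> W} V"
  by (rule subspace_intro)
    (auto simp: LinearCombinations.module_hom_add[OF f] LinearCombinations.module_hom_smult[OF f] hom_zero[OF f] subspace_elim[OF W])

lemma image_subspace:
  assumes f: "f \<in> module_hom K V V" and W: "subspace K W V"
  shows "subspace K (f ` W) V"
proof (rule subspace_intro)
  note W' = subspace_elim[OF W]
  show "f ` W \<subseteq> carrier V" using W'(1) hom_carrier[OF f] by auto
  show "\<zero>\<^bsub>V\<^esub> \<in> f ` W" using W'(2) hom_zero[OF f] by force
  show "v \<oplus>\<^bsub>V\<^esub> w \<in> f ` W" if vw: "v \<in> f ` W" "w \<in> f ` W" for v w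
  proof -
    from vw obtain x y where x: "x \<in> W" "v = f x" and y: "y \<in> W" "w = f y" by auto
    have "v \<oplus>\<^bsub>V\<^esub> w = f (x \<oplus>\<^bsub>V\<^esub> y)"
      using x y W'(1) LinearCombinations.module_hom_add[OF f, of x y] by (simp add: subset_iff)
    then show ?thesis using W'(3) x y by blast
  qed
  show "c \<odot>\<^bsub>V\<^esub> v \<in> f ` W" if c: "c \<in> carrier K" and v: "v \<in> f ` W" for c v
  proof -
    from v obtain x where x: "x \<in> W" "v = f x" by auto
    have "c \<odot>\<^bsub>V\<^esub> v = f (c \<odot>\<^bsub>V\<^esub> x)"
      using x W'(1) c LinearCombinations.module_hom_smult[OF f c, of x] by auto
    then show ?thesis using W'(4) x c by blast
  qed
qed

lemma span_subset_subspace: "subspace K W V \<Longrightarrow> S \<subseteq> W \<Longrightarrow> span S \<subseteq> W"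
  by (rule span_is_subset) auto

lemma span_of_subspace: "subspace K W V \<Longrightarrow> span W = W"
  using span_subset_subspace[of W W] in_own_span[of W] subspace_elim(1)[of W] by auto

text \<open>Linear independence in \<open>W\<close> is the same as in \<open>V\<close>, so independent subsets of \<open>W\<close> have bounded
  size and a maximal one exists; it is a basis of \<open>W\<close>.\<close>

lemma subspace_fin_dim:
  assumes fd: "fin_dim" and W: "subspace K W V"
  shows "vectorspace.fin_dim K (vs W)"
proof -
  interpret W: vectorspace K "vs W" by (rule subspace_is_vs[OF W])
  have sub: "W \<subseteq> carrier V" by (rule subspace_elim(1)[OF W])
  have li: "W.lin_dep S \<longleftrightarrow> lin_dep S" if "S \<subseteq> W" for S
    using span_li_not_depend(2)[OF that] W by auto
  let ?P = "\<lambda>S. S \<subseteq> carrier (vs W) \<and> \<not> W.lin_dep S"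
  have "\<exists>S. finite S \<and> maximal S ?P"
  proof (rule maximal_exists)
    show "finite S \<and> card S \<le> dim" if "?P S" for S
      using li_le_dim[OF fd, of S] that li[of S] sub by auto
    show "?P {}" by (auto simp: W.lin_dep_def)
  qed
  then obtain S where S: "finite S" "maximal S ?P" by auto
  then have "W.basis S" by (intro W.max_li_is_basis) auto
  then show ?thesis using S unfolding W.fin_dim_def W.basis_def by auto
qed

lemma subspace_basis_in_space:
  assumes fd: "fin_dim" and W: "subspace K W V"
  obtains S where "finite S" "S \<subseteq> W" "span S = W" "lin_indpt S"
    "vectorspace.dim K (vs W) = card S"
proof -
  interpret W: vectorspace K "vs W" by (rule subspace_is_vs[OF W])
  obtain S where S: "finite S" "W.basis S"
    using W.finite_basis_exists[OF subspace_fin_dim[OF fd W]] by auto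
  have sub: "S \<subseteq> W" using S(2) by (auto simp: W.basis_def)
  note nd = span_li_not_depend[OF sub is_module[OF W]]
  show ?thesis
    using that[OF S(1) sub] nd S(2) W.dim_basis[OF S] by (auto simp: W.basis_def)
qed

lemma subspace_dim_le:
  assumes fd: "fin_dim" and U: "subspace K U V" and W: "subspace K W V" and "W \<subseteq> U"
  shows "vectorspace.dim K (vs W) \<le> vectorspace.dim K (vs U)"
proof -
  interpret U: vectorspace K "vs U" by (rule subspace_is_vs[OF U])
  obtain S where S: "finite S" "S \<subseteq> W" "lin_indpt S" "vectorspace.dim K (vs W) = card S"
    using subspace_basis_in_space[OF fd W] by metis
  have sub: "S \<subseteq> U" using S assms(4) by auto
  show ?thesis
    using U.li_le_dim(2)[OF subspace_fin_dim[OF fd U], of S] S sub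
      span_li_not_depend(2)[OF sub is_module[OF U]] by auto
qed

lemma subspace_dim_eq_imp_eq:
  assumes fd: "fin_dim" and U: "subspace K U V" and W: "subspace K W V" and "W \<subseteq> U"
    and "vectorspace.dim K (vs W) = vectorspace.dim K (vs U)"
  shows "W = U"
proof -
  interpret U: vectorspace K "vs U" by (rule subspace_is_vs[OF U])
  obtain S where S: "finite S" "S \<subseteq> W" "span S = W" "lin_indpt S"
    "vectorspace.dim K (vs W) = card S"
    using subspace_basis_in_space[OF fd W] by metis
  have sub: "S \<subseteq> U" using S assms(4) by auto
  note nd = span_li_not_depend[OF sub is_module[OF U]]
  have "U.basis S"
    using S sub nd assms(5) by (intro U.dim_li_is_basis subspace_fin_dim[OF fd U]) auto
  then show ?thesis using S(3) nd(1) by (auto simp: U.basis_def)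
qed

lemma dim_zero_subspace: "vectorspace.dim K (vs {\<zero>\<^bsub>V\<^esub>}) = 0"
proof -
  interpret Z: vectorspace K "vs {\<zero>\<^bsub>V\<^esub>}" by (rule subspace_is_vs[OF zero_is_subspace])
  show ?thesis
    using Z.span_of_subspace[OF Z.carrier_is_subspace] by (intro Z.dim0I) simp
qed

lemma dim_injective_image:
  assumes fd: "fin_dim" and f: "f \<in> module_hom K V V" and W: "subspace K W V" and "inj_on f W"
  shows "vectorspace.dim K (vs (f ` W)) = vectorspace.dim K (vs W)"
proof -
  interpret f: linear_map K "vs W" "vs (f ` W)" f
    by (rule linear_map_between_subspaces[OF f W image_subspace[OF f W]]) auto
  show ?thesis using f.dim_eq[OF subspace_fin_dim[OF fd W]] assms(4) by auto
qed

text \<open>Rank-nullity for \<open>P\<close> on \<open>D + W\<close>: the image is \<open>D\<close> and the kernel is \<open>W\<close>.\<close>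

lemma dim_sum_of_projection:
  assumes fd: "fin_dim" and P: "P \<in> module_hom K V V"
    and D: "subspace K D V" and W: "subspace K W V"
    and PD: "\<And>d. d \<in> D \<Longrightarrow> P d = d" and PW: "\<And>v. v \<in> W \<Longrightarrow> P v = \<zero>\<^bsub>V\<^esub>"
  shows "vectorspace.dim K (vs (subspace_sum D W)) =
    vectorspace.dim K (vs D) + vectorspace.dim K (vs W)"
proof -
  let ?S = "subspace_sum D W"
  have S: "subspace K ?S V" by (rule sum_is_subspace[OF D W])
  note D' = subspace_elim[OF D] and W' = subspace_elim[OF W]
  have P_sum: "P (d \<oplus>\<^bsub>V\<^esub> v) = d" if "d \<in> D" "v \<in> W" for d v
    using that D'(1) W'(1) PD PW by (auto simp: LinearCombinations.module_hom_add[OF P] subset_iff)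
  have im: "P ` ?S = D"
  proof
    show "P ` ?S \<subseteq> D" using P_sum by (auto simp: submodule_sum_def)
    show "D \<subseteq> P ` ?S"
      using PD in_sum_vs[OF D W] by force
  qed
  have ker: "{v \<in> ?S. P v = \<zero>\<^bsub>V\<^esub>} = W"
  proof
    show "{v \<in> ?S. P v = \<zero>\<^bsub>V\<^esub>} \<subseteq> W"
      using P_sum W'(1) by (auto simp: submodule_sum_def)
    show "W \<subseteq> {v \<in> ?S. P v = \<zero>\<^bsub>V\<^esub>}"
      using PW in_sum_vs[OF W D] vsum_comm[OF D W] by auto
  qed
  interpret P: linear_map K "vs ?S" "vs D" P
    by (rule linear_map_between_subspaces[OF P S D]) (use im in auto)
  show ?thesis
    using P.rank_nullity[OF subspace_fin_dim[OF fd S]] im ker by (simp add: P.im_def P.ker_def)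
qed

text \<open>Independence is expressed by maps \<open>P t\<close> that are the identity on \<open>D t\<close> and kill the other
  members: the kernel of \<open>P t\<close> then contains the span of the others, and the members can be split
  off one at a time.\<close>

lemma dim_span_independent_family:
  assumes fd: "fin_dim" and "finite T"
    and D: "\<And>t. t \<in> T \<Longrightarrow> subspace K (D t) V"
    and P: "\<And>t. t \<in> T \<Longrightarrow> P t \<in> module_hom K V V"
    and P_same: "\<And>t d. t \<in> T \<Longrightarrow> d \<in> D t \<Longrightarrow> P t d = d"
    and P_other: "\<And>t t' d. t \<in> T \<Longrightarrow> t' \<in> T \<Longrightarrow> t \<noteq> t' \<Longrightarrow> d \<in> D t' \<Longrightarrow> P t d = \<zero>\<^bsub>V\<^esub>"
  shows "vectorspace.dim K (vs (span (\<Union>t\<in>T. D t))) = (\<Sum>t\<in>T. vectorspace.dim K (vs (D t)))"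
  using assms(2-)
proof (induction T rule: finite_induct)
  case empty
  then show ?case by (simp add: span_empty dim_zero_subspace)
next
  case (insert t T)
  let ?X = "\<Union>t\<in>T. D t"
  have X: "?X \<subseteq> carrier V" using insert.prems(1) subspace_elim(1) by blast
  have Dt: "subspace K (D t) V" using insert.prems(1) by simp
  have "?X \<subseteq> {v \<in> carrier V. P t v \<in> {\<zero>\<^bsub>V\<^esub>}}"
    using X insert.prems(4)[of t] insert.hyps(2) by fastforce
  then have ker: "span ?X \<subseteq> {v \<in> carrier V. P t v \<in> {\<zero>\<^bsub>V\<^esub>}}"
    by (intro span_subset_subspace preimage_subspace insert.prems(2) zero_is_subspace) auto
  have "span (\<Union>t\<in>insert t T. D t) = subspace_sum (D t) (span ?X)"
    using span_union_is_sum[OF subspace_elim(1)[OF Dt] X] by (simp add: span_of_subspace[OF Dt])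
  then have "vectorspace.dim K (vs (span (\<Union>t\<in>insert t T. D t))) =
      vectorspace.dim K (vs (D t)) + vectorspace.dim K (vs (span ?X))"
    using ker insert.prems(2,3)[of t]
    by (auto intro!: dim_sum_of_projection[OF fd, of "P t"] Dt span_is_subspace X)
  also have "vectorspace.dim K (vs (span ?X)) = (\<Sum>t\<in>T. vectorspace.dim K (vs (D t)))"
    by (rule insert.IH) (use insert.prems in \<open>meson insertI2\<close>)+
  finally show ?case using insert.hyps by simp
qed

end

section \<open>Matrix units acting on a vector space\<close>

text \<open>The situation of a module over \<open>Mat\<^bsub>w 0\<^esub>(K) \<times> \<dots> \<times> Mat\<^bsub>w (r - 1)\<^esub>(K)\<close>, reduced to the operators
  \<open>E j p q\<close> given by the matrix units. As the \<open>E j p p\<close> are orthogonal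
  idempotents, the last assumption says that they sum to \<open>1\<close>; the span replaces the sum because
  completeness is used to show that a vector lies in a subspace that contains its components.\<close>

locale matrix_unit_action = vectorspace K V
  for K (structure) and V :: "('a, 'v, 'd) module_scheme" +
  fixes r :: nat and w :: "nat \<Rightarrow> nat" and E :: "nat \<Rightarrow> nat \<Rightarrow> nat \<Rightarrow> 'v \<Rightarrow> 'v"
  assumes size_pos: "j < r \<Longrightarrow> 0 < w j"
    and unit_hom: "\<lbrakk>j < r; p < w j; q < w j\<rbrakk> \<Longrightarrow> E j p q \<in> module_hom K V V"
    and unit_mult: "\<lbrakk>j < r; p < w j; q < w j; q' < w j; v \<in> carrier V\<rbrakk>
      \<Longrightarrow> E j p q (E j q q' v) = E j p q' v"
    and unit_mult_zero: "\<lbrakk>j < r; p < w j; q < w j; j' < r; p' < w j'; q' < w j'; (j, q) \<noteq> (j', p');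
      v \<in> carrier V\<rbrakk> \<Longrightarrow> E j p q (E j' p' q' v) = \<zero>\<^bsub>V\<^esub>"
    and unit_complete: "v \<in> carrier V \<Longrightarrow> v \<in> span {E j p p v | j p. j < r \<and> p < w j}"
begin

text \<open>The space at a source of the quiver.\<close>

definition corner :: "nat \<Rightarrow> 'v set" where
  "corner j = E j 0 0 ` carrier V"

definition stable :: "'v set \<Rightarrow> bool" where
  "stable U \<longleftrightarrow> (\<forall>j<r. \<forall>p<w j. \<forall>q<w j. E j p q ` U \<subseteq> U)"

text \<open>The part of the sink that is forced by spaces \<open>S j\<close> at the sources, as the span of their images
  under all arrows.\<close>

definition generated :: "(nat \<Rightarrow> 'v set) \<Rightarrow> 'v set" where
  "generated S = span (\<Union>(j, k) \<in> Sigma {..<r} (\<lambda>j. {..<w j}). E j k 0 ` S j)"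

lemma unit_carrier: "\<lbrakk>j < r; p < w j; q < w j; v \<in> carrier V\<rbrakk> \<Longrightarrow> E j p q v \<in> carrier V"
  by (rule hom_carrier[OF unit_hom])

lemma corner_subspace: "j < r \<Longrightarrow> subspace K (corner j) V"
  unfolding corner_def by (intro image_subspace unit_hom carrier_is_subspace size_pos)

lemma corner_carrier: "j < r \<Longrightarrow> corner j \<subseteq> carrier V"
  by (rule subspace_elim(1)[OF corner_subspace])

lemma unit_on_corner:
  assumes "j < r" "p < w j" "k < w j" "s \<in> corner j"
  shows "E j p k (E j k 0 s) = E j p 0 s"
  using assms corner_carrier by (intro unit_mult) (auto simp: size_pos)

lemma unit_zero_on_corner:
  assumes "j < r" "p < w j" "q < w j" "j' < r" "k < w j'" "s \<in> corner j'" "(j, q) \<noteq> (j', k)"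
  shows "E j p q (E j' k 0 s) = \<zero>\<^bsub>V\<^esub>"
  using assms corner_carrier by (intro unit_mult_zero) (auto simp: size_pos)

lemma corner_idempotent: "j < r \<Longrightarrow> s \<in> corner j \<Longrightarrow> E j 0 0 s = s"
  using unit_mult[of j 0 0 0] size_pos[of j] by (auto simp: corner_def)

lemma inj_on_corner: "j < r \<Longrightarrow> k < w j \<Longrightarrow> inj_on (E j k 0) (corner j)"
  by (rule inj_on_inverseI[of _ "E j 0 k"]) (simp add: unit_on_corner corner_idempotent size_pos)

context
  fixes S :: "nat \<Rightarrow> 'v set"
  assumes S: "\<And>j. j < r \<Longrightarrow> subspace K (S j) V" and S_corner: "\<And>j. j < r \<Longrightarrow> S j \<subseteq> corner j"
begin

lemma generators_carrier: "(\<Union>(j, k) \<in> Sigma {..<r} (\<lambda>j. {..<w j}). E j k 0 ` S j) \<subseteq> carrier V"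
  using S_corner corner_carrier by (auto intro!: unit_carrier simp: size_pos)

lemma generated_subspace: "subspace K (generated S) V"
  unfolding generated_def by (rule span_is_subspace[OF generators_carrier])

lemma generator_in_generated: "j < r \<Longrightarrow> k < w j \<Longrightarrow> s \<in> S j \<Longrightarrow> E j k 0 s \<in> generated S"
  unfolding generated_def by (rule subsetD[OF in_own_span[OF generators_carrier]]) auto

lemma generated_subset:
  assumes "subspace K U V" and "\<And>j k s. j < r \<Longrightarrow> k < w j \<Longrightarrow> s \<in> S j \<Longrightarrow> E j k 0 s \<in> U"
  shows "generated S \<subseteq> U"
  unfolding generated_def by (rule span_subset_subspace) (use assms in auto)

text \<open>The idempotents \<open>E j k k\<close> separate the generating spaces \<open>E j k 0 ` S j\<close>, and each of these is
  an injective image of \<open>S j\<close>; the index \<open>k\<close> accounts for the factor \<open>w j\<close>.\<close>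

lemma dim_generated:
  assumes fd: "fin_dim"
  shows "vectorspace.dim K (vs (generated S)) = (\<Sum>j<r. w j * vectorspace.dim K (vs (S j)))"
proof -
  let ?T = "Sigma {..<r} (\<lambda>j. {..<w j})"
  let ?D = "\<lambda>t. E (fst t) (snd t) 0 ` S (fst t)"
  have "generated S = span (\<Union>t\<in>?T. ?D t)"
    by (simp add: generated_def split_def)
  also have "vectorspace.dim K (vs \<dots>) = (\<Sum>t\<in>?T. vectorspace.dim K (vs (?D t)))"
  proof (rule dim_span_independent_family[OF fd, where P = "\<lambda>t. E (fst t) (snd t) (snd t)"])
    fix t t' d assume t: "t \<in> ?T" "t' \<in> ?T" "t \<noteq> t'" and d: "d \<in> ?D t'"
    then show "E (fst t) (snd t) (snd t) d = \<zero>\<^bsub>V\<^esub>"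
      by (auto intro!: unit_zero_on_corner intro: subsetD[OF S_corner])
  qed (use S S_corner in \<open>auto intro!: image_subspace unit_hom unit_on_corner
      intro: subsetD[OF S_corner] simp: size_pos\<close>)
  also have "\<dots> = (\<Sum>j<r. \<Sum>k<w j. vectorspace.dim K (vs (E j k 0 ` S j)))"
    by (simp add: sum.Sigma split_def)
  also have "\<dots> = (\<Sum>j<r. \<Sum>k<w j. vectorspace.dim K (vs (S j)))"
    using S S_corner
    by (intro sum.cong refl dim_injective_image[OF fd] unit_hom inj_on_subset[OF inj_on_corner])
      (auto simp: size_pos)
  finally show ?thesis by simp
qed

text \<open>A matrix unit sends each generator to a generator or to zero.\<close>

lemma generated_stable: "stable (generated S)"
  unfolding stable_def
proof (intro allI impI)
  fix j p q assume jpq: "j < r" "p < w j" "q < w j"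
  have "generated S \<subseteq> {v \<in> carrier V. E j p q v \<in> generated S}"
  proof (rule generated_subset)
    show "subspace K {v \<in> carrier V. E j p q v \<in> generated S} V"
      by (intro preimage_subspace unit_hom jpq generated_subspace)
    fix j' k s assume s: "j' < r" "k < w j'" "s \<in> S j'"
    then have c: "s \<in> corner j'" using S_corner by auto
    have "E j p q (E j' k 0 s) \<in> generated S"
    proof (cases "(j, q) = (j', k)")
      case True
      then show ?thesis
        using s c jpq unit_on_corner[of j p q s] generator_in_generated[of j p s] by simp
    next
      case False
      then show ?thesis
        using s c jpq unit_zero_on_corner[of j p q j' k s] subspace_elim(2)[OF generated_subspace]
        by simp
    qed
    then show "E j' k 0 s \<in> {v \<in> carrier V. E j p q v \<in> generated S}"
      using s c corner_carrier by (auto intro!: unit_carrier simp: size_pos)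
  qed
  then show "E j p q ` generated S \<subseteq> generated S" by auto
qed

text \<open>\<open>E j 0 0\<close> fixes the generators that come from \<open>S j\<close> with \<open>k = 0\<close> and kills all others, so
  no vector outside \<open>S j\<close> enters the corner.\<close>

lemma corner_of_generated:
  assumes j: "j < r" and v: "v \<in> generated S"
  shows "E j 0 0 v \<in> S j"
proof -
  have "generated S \<subseteq> {v \<in> carrier V. E j 0 0 v \<in> S j}"
  proof (rule generated_subset)
    show "subspace K {v \<in> carrier V. E j 0 0 v \<in> S j} V"
      by (intro preimage_subspace unit_hom j S size_pos)
    fix j' k s assume s: "j' < r" "k < w j'" "s \<in> S j'"
    then have c: "s \<in> corner j'" using S_corner by auto
    have "E j 0 0 (E j' k 0 s) \<in> S j"
    proof (cases "(j, 0) = (j', k)")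
      case True
      then show ?thesis
        using s c j unit_on_corner[of j 0 0 s] corner_idempotent[of j s] by (simp add: size_pos)
    next
      case False
      then show ?thesis
        using s c j unit_zero_on_corner[of j 0 0 j' k s] subspace_elim(2)[OF S[OF j]]
        by (simp add: size_pos)
    qed
    then show "E j' k 0 s \<in> {v \<in> carrier V. E j 0 0 v \<in> S j}"
      using s c corner_carrier by (auto intro!: unit_carrier simp: size_pos)
  qed
  then show ?thesis using v by auto
qed

end

text \<open>Each component \<open>E j p p v\<close> of \<open>v \<in> U\<close> factors as \<open>E j p 0 (E j 0 0 (E j 0 p v))\<close>, and
  \<open>E j 0 p v\<close> is again in \<open>U\<close>.\<close>

lemma stable_eq_generated:
  assumes U: "subspace K U V" and st: "stable U"
  shows "generated (\<lambda>j. E j 0 0 ` U) = U"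
proof
  note U' = subspace_elim(1)[OF U]
  have stD: "E j p q u \<in> U" if "j < r" "p < w j" "q < w j" "u \<in> U" for j p q u
    using st that unfolding stable_def by blast
  have S: "subspace K (E j 0 0 ` U) V" "E j 0 0 ` U \<subseteq> corner j" "E j 0 0 ` U \<subseteq> U" if "j < r" for j
    using that U' st by (auto simp: corner_def stable_def size_pos intro!: image_subspace unit_hom U)
  show "generated (\<lambda>j. E j 0 0 ` U) \<subseteq> U"
    using S stD by (intro generated_subset[OF _ _ U]) (auto simp: size_pos)
  show "U \<subseteq> generated (\<lambda>j. E j 0 0 ` U)"
  proof
    fix v assume v: "v \<in> U"
    have "E j p p v \<in> generated (\<lambda>j. E j 0 0 ` U)" if jp: "j < r" "p < w j" for j p
    proof -
      have "E j 0 p v \<in> U" using stD v jp by (simp add: size_pos)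
      then have "E j p 0 (E j 0 0 (E j 0 p v)) \<in> generated (\<lambda>j. E j 0 0 ` U)"
        using S jp by (intro generator_in_generated) auto
      also have "E j p 0 (E j 0 0 (E j 0 p v)) = E j p p v"
        using v U' jp by (auto simp: unit_mult size_pos subset_iff)
      finally show ?thesis .
    qed
    then have "span {E j p p v | j p. j < r \<and> p < w j} \<subseteq> generated (\<lambda>j. E j 0 0 ` U)"
      using S by (intro span_subset_subspace generated_subspace) auto
    then show "v \<in> generated (\<lambda>j. E j 0 0 ` U)" using unit_complete[of v] v U' by auto
  qed
qed

lemma dim_stable:
  assumes "fin_dim" and U: "subspace K U V" and st: "stable U"
  shows "vectorspace.dim K (vs U) = (\<Sum>j<r. w j * vectorspace.dim K (vs (E j 0 0 ` U)))"
proof -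
  have "vectorspace.dim K (vs (generated (\<lambda>j. E j 0 0 ` U))) =
      (\<Sum>j<r. w j * vectorspace.dim K (vs (E j 0 0 ` U)))"
    using subspace_elim(1)[OF U]
    by (intro dim_generated assms(1)) (auto simp: corner_def size_pos intro!: image_subspace unit_hom U)
  then show ?thesis by (simp add: stable_eq_generated[OF U st])
qed

lemma carrier_stable: "stable (carrier V)"
  by (auto simp: stable_def intro!: unit_carrier)

text \<open>The contribution of one factor of the free product to the weight: it is never positive, and it
  vanishes only if the spaces at the sources generate the space at the sink.\<close>

lemma weighted_dim_le:
  assumes fd: "fin_dim" and U: "subspace K U V"
    and S: "\<And>j. j < r \<Longrightarrow> subspace K (S j) V" and S_corner: "\<And>j. j < r \<Longrightarrow> S j \<subseteq> corner j"
    and SU: "\<And>j k s. j < r \<Longrightarrow> k < w j \<Longrightarrow> s \<in> S j \<Longrightarrow> E j k 0 s \<in> U"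
  shows "(\<Sum>j<r. w j * vectorspace.dim K (vs (S j))) \<le> vectorspace.dim K (vs U)"
    and "(\<Sum>j<r. w j * vectorspace.dim K (vs (S j))) = vectorspace.dim K (vs U) \<Longrightarrow> generated S = U"
proof -
  have le: "generated S \<subseteq> U"
    by (rule generated_subset) (fact S S_corner U SU)+
  have sub: "subspace K (generated S) V" by (rule generated_subspace) (fact S S_corner)+
  have dim: "vectorspace.dim K (vs (generated S)) = (\<Sum>j<r. w j * vectorspace.dim K (vs (S j)))"
    by (rule dim_generated) (fact S S_corner fd)+
  show "(\<Sum>j<r. w j * vectorspace.dim K (vs (S j))) \<le> vectorspace.dim K (vs U)"
    using subspace_dim_le[OF fd U sub le] dim by simp
  show "generated S = U"
    if "(\<Sum>j<r. w j * vectorspace.dim K (vs (S j))) = vectorspace.dim K (vs U)"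
    using subspace_dim_eq_imp_eq[OF fd U sub le] dim that by simp
qed

end

section \<open>Stability of \<open>F(M)\<close> in terms of matrix units\<close>

text \<open>The weight \<open>- m\<close> of the sink is distributed evenly over the \<open>m\<close> factors.\<close>

lemma weight_Gamma:
  "weight (Gamma m r w) (theta m w) d =
    (\<Sum>i<m. (\<Sum>j<r i. int (w i j * d (Source i j))) - int (d Sink))"
proof -
  let ?S = "Sigma {..<m} (\<lambda>i. {..<r i})"
  have verts: "verts (Gamma m r w) = insert Sink ((\<lambda>(i, j). Source i j) ` ?S)"
    by (auto simp: Gamma_def)
  have inj: "inj_on (\<lambda>(i, j). Source i j) ?S" by (auto simp: inj_on_def)
  have "(\<Sum>x\<in>(\<lambda>(i, j). Source i j) ` ?S. theta m w x * int (d x)) =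
      (\<Sum>i<m. \<Sum>j<r i. int (w i j * d (Source i j)))"
    by (subst sum.reindex[OF inj]) (simp add: sum.Sigma split_def)
  then have "weight (Gamma m r w) (theta m w) d =
      - int m * int (d Sink) + (\<Sum>i<m. \<Sum>j<r i. int (w i j * d (Source i j)))"
    unfolding weight_def verts by (subst sum.insert) auto
  then show ?thesis by (simp add: sum_subtractf)
qed

text \<open>One system of matrix units on \<open>M\<close> for each factor of the free product, with no relation between
  different factors.\<close>

locale matrix_unit_actions = vectorspace "class_ring :: 'k ring" M
  for M :: "('k::field, 'v) module" +
  fixes m :: nat and r :: "nat \<Rightarrow> nat" and w :: "nat \<Rightarrow> nat \<Rightarrow> nat"
    and e :: "nat \<Rightarrow> nat \<Rightarrow> nat \<Rightarrow> nat \<Rightarrow> 'a" and \<rho> :: "'a \<Rightarrow> 'v \<Rightarrow> 'v"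
  assumes fin: "fin_dim"
    and action: "i < m \<Longrightarrow> matrix_unit_action class_ring M (r i) (w i) (\<lambda>j p q. \<rho> (e i j p q))"
begin

abbreviation stable_at :: "nat \<Rightarrow> 'v set \<Rightarrow> bool" where
  "stable_at i \<equiv> matrix_unit_action.stable (r i) (w i) (\<lambda>j p q. \<rho> (e i j p q))"

abbreviation corner_at :: "nat \<Rightarrow> nat \<Rightarrow> 'v set" where
  "corner_at i \<equiv> matrix_unit_action.corner M (\<lambda>j p q. \<rho> (e i j p q))"

abbreviation FM :: "('k, vertex, nat \<times> nat \<times> nat, 'v) qrep" where
  "FM \<equiv> F_obj e M \<rho>"

abbreviation (input) Q where "Q \<equiv> Gamma m r w"

lemma vspace_FM:
  "vspace FM Sink = M"
  "i < m \<Longrightarrow> vspace FM (Source i j) = vs (corner_at i j)"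
  by (simp_all add: F_obj_def matrix_unit_action.corner_def[OF action])

lemma vmap_FM: "vmap FM (i, j, k) = \<rho> (e i j k 0)"
  by (simp add: F_obj_def)

lemma head_tail_Gamma: "tail Q (i, j, k) = Source i j" "head Q (i, j, k) = Sink"
  by (simp_all add: Gamma_def)

lemma ball_verts_Gamma:
  "(\<forall>x\<in>verts Q. P x) \<longleftrightarrow> P Sink \<and> (\<forall>i<m. \<forall>j<r i. P (Source i j))"
  by (auto simp: Gamma_def)

lemma bex_verts_Gamma:
  "(\<exists>x\<in>verts Q. P x) \<longleftrightarrow> P Sink \<or> (\<exists>i<m. \<exists>j<r i. P (Source i j))"
  by (auto simp: Gamma_def)

lemma ball_arcs_Gamma:
  "(\<forall>a\<in>arcs Q. P a) \<longleftrightarrow> (\<forall>i<m. \<forall>j<r i. \<forall>k<w i j. P (i, j, k))"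
  by (auto simp: Gamma_def)

lemma corner_at_subspace: "i < m \<Longrightarrow> j < r i \<Longrightarrow> subspace class_ring (corner_at i j) M"
  by (rule matrix_unit_action.corner_subspace[OF action])

lemma subrep_FM_iff:
  "subrep Q FM S \<longleftrightarrow> subspace class_ring (S Sink) M \<and>
    (\<forall>i<m. \<forall>j<r i. subspace class_ring (S (Source i j)) M \<and> S (Source i j) \<subseteq> corner_at i j \<and>
      (\<forall>k<w i j. \<forall>s\<in>S (Source i j). \<rho> (e i j k 0) s \<in> S Sink))"
proof -
  have "subspace class_ring (S (Source i j)) (vspace FM (Source i j)) \<longleftrightarrow>
      subspace class_ring (S (Source i j)) M \<and> S (Source i j) \<subseteq> corner_at i j"
    if "i < m" "j < r i" for i j
    using subspace_in_subspace_iff[OF corner_at_subspace[OF that]] that by (simp add: vspace_FM)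
  then show ?thesis
    unfolding subrep_def ball_verts_Gamma ball_arcs_Gamma vspace_FM(1) vmap_FM head_tail_Gamma
    by (simp cong: imp_cong) blast
qed

lemma dim_vector_restrict:
  "dim_vector (restrict_rep FM S) Sink = vectorspace.dim class_ring (vs (S Sink))"
  "i < m \<Longrightarrow> dim_vector (restrict_rep FM S) (Source i j) =
    vectorspace.dim class_ring (vs (S (Source i j)))"
  by (simp_all add: dim_vector_def restrict_rep_def vspace_FM)

lemma weight_restrict:
  "weight Q (theta m w) (dim_vector (restrict_rep FM S)) =
    (\<Sum>i<m. (\<Sum>j<r i. int (w i j * vectorspace.dim class_ring (vs (S (Source i j))))) -
      int (vectorspace.dim class_ring (vs (S Sink))))"
  unfolding weight_Gamma dim_vector_restrict(1)
  by (rule sum.cong) (simp_all add: dim_vector_restrict)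

text \<open>A sum of nonpositive contributions vanishes only if each contribution does.\<close>

lemma subrep_weight:
  assumes S: "subrep Q FM S"
  shows "weight Q (theta m w) (dim_vector (restrict_rep FM S)) \<le> 0"
    and "weight Q (theta m w) (dim_vector (restrict_rep FM S)) = 0 \<Longrightarrow> i < m \<Longrightarrow>
      matrix_unit_action.generated class_ring M (r i) (w i) (\<lambda>j p q. \<rho> (e i j p q))
        (\<lambda>j. S (Source i j)) = S Sink"
proof -
  let ?f = "\<lambda>i. (\<Sum>j<r i. int (w i j * vectorspace.dim class_ring (vs (S (Source i j))))) -
    int (vectorspace.dim class_ring (vs (S Sink)))"
  note S' = S[unfolded subrep_FM_iff]
  have le: "?f i \<le> 0" if i: "i < m" for i
    using matrix_unit_action.weighted_dim_le(1)[OF action[OF i] fin, of "S Sink" "\<lambda>j. S (Source i j)"] S' i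
    by (simp flip: of_nat_mult of_nat_sum)
  show "weight Q (theta m w) (dim_vector (restrict_rep FM S)) \<le> 0"
    unfolding weight_restrict by (rule sum_nonpos) (use le in auto)
  assume w0: "weight Q (theta m w) (dim_vector (restrict_rep FM S)) = 0" and i: "i < m"
  have "(\<Sum>i<m. - ?f i) = 0"
    using w0 unfolding weight_restrict sum_negf by simp
  then have "?f i = 0"
    using le i by (subst (asm) sum_nonneg_eq_0_iff) auto
  then show "matrix_unit_action.generated class_ring M (r i) (w i) (\<lambda>j p q. \<rho> (e i j p q))
      (\<lambda>j. S (Source i j)) = S Sink"
    using S' i
    by (intro matrix_unit_action.weighted_dim_le(2)[OF action[OF i] fin])
      (simp_all flip: of_nat_mult of_nat_sum)
qed

text \<open>Here \<open>S\<close> is \<open>F(N)\<close> for the submodule \<open>N\<close>.\<close>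

lemma stable_weight:
  assumes N: "subspace class_ring N M" and st: "\<And>i. i < m \<Longrightarrow> stable_at i N"
    and S: "S Sink = N" "\<And>i j. S (Source i j) = \<rho> (e i j 0 0) ` N"
  shows "subrep Q FM S" "weight Q (theta m w) (dim_vector (restrict_rep FM S)) = 0"
proof -
  show "subrep Q FM S"
    unfolding subrep_FM_iff
  proof (intro conjI allI impI ballI)
    show "subspace class_ring (S Sink) M" using N S by simp
    fix i j assume ij: "i < m" "j < r i"
    interpret matrix_unit_action class_ring M "r i" "w i" "\<lambda>j p q. \<rho> (e i j p q)"
      by (rule action) fact
    have st': "\<rho> (e i j p q) v \<in> N" if "p < w i j" "q < w i j" "v \<in> N" for p q v
      using st[OF ij(1)] that ij unfolding stable_def by blast
    show "subspace class_ring (S (Source i j)) M"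
      using image_subspace[OF unit_hom N] ij by (simp add: S size_pos)
    show "S (Source i j) \<subseteq> corner_at i j"
      using subspace_elim(1)[OF N] by (auto simp: S corner_def)
    show "\<rho> (e i j k 0) s \<in> S Sink" if "k < w i j" "s \<in> S (Source i j)" for k s
      using that st' ij by (auto simp: S size_pos)
  qed
  have "int (vectorspace.dim class_ring (vs N)) =
      (\<Sum>j<r i. int (w i j * vectorspace.dim class_ring (vs (\<rho> (e i j 0 0) ` N))))" if "i < m" for i
    using matrix_unit_action.dim_stable[OF action fin N st] that
    by (simp flip: of_nat_mult of_nat_sum)
  then show "weight Q (theta m w) (dim_vector (restrict_rep FM S)) = 0"
    unfolding weight_restrict by (simp add: S)
qed

lemma quiver_rep_FM: "quiver_rep Q FM"
  unfolding quiver_rep_def ball_verts_Gamma ball_arcs_Gamma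
proof (intro conjI allI impI)
  show "vectorspace class_ring (vspace FM Sink)" "vectorspace.fin_dim class_ring (vspace FM Sink)"
    using fin by (simp_all add: vspace_FM vectorspace_axioms)
  fix i j assume ij: "i < m" "j < r i"
  note c = corner_at_subspace[OF ij]
  show "vectorspace class_ring (vspace FM (Source i j))"
    "vectorspace.fin_dim class_ring (vspace FM (Source i j))"
    using subspace_is_vs[OF c] subspace_fin_dim[OF fin c] ij by (simp_all add: vspace_FM)
  fix k assume k: "k < w i j"
  interpret matrix_unit_action class_ring M "r i" "w i" "\<lambda>j p q. \<rho> (e i j p q)"
    by (rule action) fact
  have "linear_map class_ring (vs (corner_at i j)) (vs (carrier M)) (\<rho> (e i j k 0))"
    using ij k corner_carrier
    by (intro linear_map_between_subspaces c carrier_is_subspace unit_hom)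
      (auto intro!: unit_carrier simp: size_pos)
  then show "linear_map class_ring (vspace FM (tail Q (i, j, k))) (vspace FM (head Q (i, j, k)))
      (vmap FM (i, j, k))"
    using ij by (simp add: head_tail_Gamma vmap_FM vspace_FM)
qed

lemma dim_vector_FM:
  "dim_vector FM = dim_vector (restrict_rep FM (\<lambda>x. carrier (vspace FM x)))"
  by (rule ext) (simp add: dim_vector_def restrict_rep_def)

lemma weight_FM: "weight Q (theta m w) (dim_vector FM) = 0"
proof -
  have "stable_at i (carrier M)" if "i < m" for i
    by (rule matrix_unit_action.carrier_stable[OF action[OF that]])
  then show ?thesis
    unfolding dim_vector_FM by (intro stable_weight(2)[OF carrier_is_subspace]) (simp_all add: F_obj_def)
qed

text \<open>Both directions match proper nonzero subrepresentations of weight \<open>0\<close> with proper nonzero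
  submodules. From a submodule \<open>N\<close> to \<open>F(N)\<close> this is \<open>stable_weight\<close>. From a subrepresentation to
  its space at the sink one must also see that it is determined by that space: it is zero if the
  space is zero, and everything if the space is \<open>M\<close>.\<close>

theorem theta_stable_FM_iff:
  "theta_stable Q (theta m w) FM \<longleftrightarrow> carrier M \<noteq> {\<zero>\<^bsub>M\<^esub>} \<and>
    (\<forall>N. subspace class_ring N M \<and> (\<forall>i<m. stable_at i N) \<longrightarrow> N = {\<zero>\<^bsub>M\<^esub>} \<or> N = carrier M)"
  (is "?L \<longleftrightarrow> ?R")
proof
  assume L: ?L
  have "carrier M \<noteq> {\<zero>\<^bsub>M\<^esub>}"
  proof
    assume M0: "carrier M = {\<zero>\<^bsub>M\<^esub>}"
    have "corner_at i j = {\<zero>\<^bsub>M\<^esub>}" if "i < m" "j < r i" for i j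
      using subspace_elim(1,2)[OF corner_at_subspace[OF that]] M0 by auto
    then have "\<not> nonzero_rep Q FM"
      unfolding nonzero_rep_def bex_verts_Gamma by (auto simp: vspace_FM M0)
    then show False using L by (simp add: theta_stable_def)
  qed
  moreover have "N = {\<zero>\<^bsub>M\<^esub>} \<or> N = carrier M"
    if N: "subspace class_ring N M" and st: "\<forall>i<m. stable_at i N" for N
  proof (rule ccontr)
    assume N_proper: "\<not> (N = {\<zero>\<^bsub>M\<^esub>} \<or> N = carrier M)"
    define S where "S x = (case x of Sink \<Rightarrow> N | Source i j \<Rightarrow> \<rho> (e i j 0 0) ` N)" for x
    have S: "S Sink = N" "\<And>i j. S (Source i j) = \<rho> (e i j 0 0) ` N" by (simp_all add: S_def)
    note sw = stable_weight[of N S, OF N _ S]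
    have "proper_subrep Q FM S"
      using sw(1) st N_proper by (auto simp: proper_subrep_def bex_verts_Gamma S vspace_FM)
    moreover have "nonzero_rep Q (restrict_rep FM S)"
      using N_proper by (simp add: nonzero_rep_def bex_verts_Gamma restrict_rep_def S vspace_FM)
    ultimately have "weight Q (theta m w) (dim_vector (restrict_rep FM S)) < 0"
      using L by (simp add: theta_stable_def)
    then show False using sw(2) st by simp
  qed
  ultimately show ?R by blast
next
  assume R: ?R
  have "weight Q (theta m w) (dim_vector (restrict_rep FM S)) < 0"
    if S: "proper_subrep Q FM S" and nz: "nonzero_rep Q (restrict_rep FM S)" for S
  proof (rule ccontr)
    assume nonneg: "\<not> weight Q (theta m w) (dim_vector (restrict_rep FM S)) < 0"
    have sub: "subrep Q FM S" using S by (simp add: proper_subrep_def)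
    with nonneg have w0: "weight Q (theta m w) (dim_vector (restrict_rep FM S)) = 0"
      using subrep_weight(1)[of S] by simp
    note S' = sub[unfolded subrep_FM_iff]
    note gen = subrep_weight(2)[OF sub w0]
    have st: "stable_at i (S Sink)" if i: "i < m" for i
      using matrix_unit_action.generated_stable[OF action[OF i], of "\<lambda>j. S (Source i j)"] S' i gen[OF i]
      by simp
    \<comment> \<open>A zero weight forces \<open>S\<close> to contain, at each source, all corner vectors of its sink part.\<close>
    have corner_in: "s \<in> corner_at i j \<Longrightarrow> s \<in> S Sink \<Longrightarrow> s \<in> S (Source i j)"
      if ij: "i < m" "j < r i" for i j s
      using matrix_unit_action.corner_of_generated[OF action[OF ij(1)], of "\<lambda>j. S (Source i j)" j s]
        matrix_unit_action.corner_idempotent[OF action[OF ij(1)] ij(2)] S' ij gen[OF ij(1)] by simp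
    have into: "s \<in> S Sink" if ij: "i < m" "j < r i" and s: "s \<in> S (Source i j)" for i j s
    proof -
      have "0 < w i j" by (rule matrix_unit_action.size_pos[OF action]) fact+
      then have "\<rho> (e i j 0 0) s \<in> S Sink" using S' ij s by blast
      moreover have "s \<in> corner_at i j" using S' ij s by blast
      ultimately show ?thesis
        using matrix_unit_action.corner_idempotent[OF action[OF ij(1)] ij(2)] by simp
    qed
    have "S Sink = {\<zero>\<^bsub>M\<^esub>} \<or> S Sink = carrier M" using R S' st by blast
    then show False
    proof
      assume S0: "S Sink = {\<zero>\<^bsub>M\<^esub>}"
      have "S (Source i j) = {\<zero>\<^bsub>M\<^esub>}" if "i < m" "j < r i" for i j
        using into[OF that] S0 subspace_elim(2)[of "S (Source i j)"] S' that by blast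
      then show False
        using nz S0 by (auto simp: nonzero_rep_def bex_verts_Gamma restrict_rep_def vspace_FM)
    next
      assume S1: "S Sink = carrier M"
      have "S (Source i j) = corner_at i j" if ij: "i < m" "j < r i" for i j
        using corner_in[OF ij] S1 S' ij subspace_elim(1)[OF corner_at_subspace[OF ij]] by blast
      then show False
        using S S1 by (auto simp: proper_subrep_def bex_verts_Gamma vspace_FM)
    qed
  qed
  moreover have "nonzero_rep Q FM"
    using R by (simp add: nonzero_rep_def bex_verts_Gamma vspace_FM)
  ultimately show ?L
    using quiver_rep_FM weight_FM by (simp add: theta_stable_def)
qed

end

section \<open>Modules over a product of matrix algebras\<close>

lemma k_algebra_module_mat: "k_algebra (module_mat TYPE('k::field) n n)" (is "k_algebra ?M")
proof -
  have "ring ?M"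
  proof (rule ringI)
    show "abelian_group ?M" by (rule abelian_group_mat)
    show "Group.monoid ?M" by (rule monoidI) (auto simp: module_mat_simps)
  qed (auto simp: module_mat_simps add_mult_distrib_mat mult_add_distrib_mat)
  moreover have "Module.module class_ring ?M"
    using matrix_vs[where ?'a='k] by (simp add: vectorspace_def)
  ultimately show ?thesis
    by (intro k_algebra.intro k_algebra_axioms.intro) (auto simp: module_mat_simps)
qed

lemma product_algebra_simps:
  "carrier (product_algebra I B) = (\<Pi>\<^sub>E j\<in>I. carrier (B j))"
  "x \<otimes>\<^bsub>product_algebra I B\<^esub> y = (\<lambda>j\<in>I. x j \<otimes>\<^bsub>B j\<^esub> y j)"
  "\<one>\<^bsub>product_algebra I B\<^esub> = (\<lambda>j\<in>I. \<one>\<^bsub>B j\<^esub>)"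
  "\<zero>\<^bsub>product_algebra I B\<^esub> = (\<lambda>j\<in>I. \<zero>\<^bsub>B j\<^esub>)"
  "x \<oplus>\<^bsub>product_algebra I B\<^esub> y = (\<lambda>j\<in>I. x j \<oplus>\<^bsub>B j\<^esub> y j)"
  "c \<odot>\<^bsub>product_algebra I B\<^esub> x = (\<lambda>j\<in>I. c \<odot>\<^bsub>B j\<^esub> x j)"
  by (simp_all add: product_algebra_def)

lemma k_algebra_product_algebra:
  fixes B :: "'i \<Rightarrow> ('k::field, 'a) module"
  assumes B: "\<And>j. j \<in> I \<Longrightarrow> k_algebra (B j)"
  shows "k_algebra (product_algebra I B)" (is "k_algebra ?P")
proof -
  have R: "ring (B j)" and Md: "Module.module class_ring (B j)" if "j \<in> I" for j
    using B[OF that] by (simp_all add: k_algebra_def)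
  note R_simps = ring.ring_simprules[OF R]
  note Md_simps =
    Module.module.smult_l_distr[OF Md, simplified] Module.module.smult_r_distr[OF Md, simplified]
    Module.module.smult_assoc1[OF Md, simplified] Module.module.smult_one[OF Md, simplified]
  have sm: "c \<odot>\<^bsub>B j\<^esub> x \<in> carrier (B j)" if "j \<in> I" "x \<in> carrier (B j)" for c j x
    using Module.module.smult_closed[OF Md[OF that(1)], of c x] that by simp
  have mem: "x j \<in> carrier (B j)" if "x \<in> carrier ?P" "j \<in> I" for x j
    using that by (auto simp: product_algebra_simps)
  have restrict_closed: "restrict x I \<in> carrier ?P" if "\<And>j. j \<in> I \<Longrightarrow> x j \<in> carrier (B j)" for x
    using that by (simp add: product_algebra_simps)
  have eqI: "x = y" if "x \<in> carrier ?P" "y \<in> carrier ?P" "\<And>j. j \<in> I \<Longrightarrow> x j = y j" for x y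
    using that by (auto simp: product_algebra_simps intro: PiE_ext)
  note ops = product_algebra_simps(2-)[of I B]
  have ab: "abelian_group ?P"
  proof (rule abelian_groupI)
    fix x assume x: "x \<in> carrier ?P"
    show "\<exists>y\<in>carrier ?P. y \<oplus>\<^bsub>?P\<^esub> x = \<zero>\<^bsub>?P\<^esub>"
      using abelian_group.l_neg[OF ring.is_abelian_group[OF R]]
        abelian_group.a_inv_closed[OF ring.is_abelian_group[OF R]] mem[OF x]
      by (intro bexI[of _ "\<lambda>j\<in>I. \<ominus>\<^bsub>B j\<^esub> x j"]) (auto simp: ops intro!: restrict_ext restrict_closed)
  qed (auto simp: ops mem R_simps intro!: eqI restrict_closed)
  have "ring ?P"
  proof (rule ringI)
    show "Group.monoid ?P"
      by (rule monoidI) (auto simp: ops mem R_simps monoid.r_one[OF ring.is_monoid[OF R]] intro!: eqI restrict_closed)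
  qed (auto simp: ab ops mem R_simps intro!: eqI restrict_closed)
  moreover have "Module.module class_ring ?P"
  proof (rule moduleI)
    show "cring (class_ring :: 'k ring)" ..
  qed (auto simp: ab ops mem sm R_simps Md_simps intro!: eqI restrict_closed)
  ultimately show ?thesis
    by (intro k_algebra.intro k_algebra_axioms.intro)
      (auto simp: ops mem sm R_simps k_algebra.smult_mult_left[OF B] k_algebra.smult_mult_right[OF B]
        intro!: eqI restrict_closed)
qed

lemma k_algebra_matrix_product_algebra:
  "k_algebra (matrix_product_algebra r w :: ('k::field, nat \<Rightarrow> 'k mat) module)"
  unfolding matrix_product_algebra_def by (intro k_algebra_product_algebra k_algebra_module_mat)

lemma matrix_product_simps:
  "carrier (matrix_product_algebra r w) = (\<Pi>\<^sub>E j\<in>{..<r}. carrier_mat (w j) (w j))"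
  "x \<otimes>\<^bsub>matrix_product_algebra r w\<^esub> y = (\<lambda>j\<in>{..<r}. x j * y j)"
  "\<one>\<^bsub>matrix_product_algebra r w\<^esub> = (\<lambda>j\<in>{..<r}. 1\<^sub>m (w j))"
  "\<zero>\<^bsub>matrix_product_algebra r w\<^esub> = (\<lambda>j\<in>{..<r}. 0\<^sub>m (w j) (w j))"
  "x \<oplus>\<^bsub>matrix_product_algebra r w\<^esub> y = (\<lambda>j\<in>{..<r}. x j + y j)"
  "c \<odot>\<^bsub>matrix_product_algebra r w\<^esub> x = (\<lambda>j\<in>{..<r}. c \<cdot>\<^sub>m x j)"
  by (simp_all add: matrix_product_algebra_def product_algebra_simps module_mat_simps)

lemma matrix_product_unit_carrier:
  "matrix_product_unit r w j p q \<in> carrier (matrix_product_algebra r w)"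
  by (auto simp: matrix_product_simps matrix_product_unit_def)

lemma matrix_product_unit_mult:
  assumes "q < w j"
  shows "(matrix_product_unit r w j p q :: nat \<Rightarrow> 'k::field mat) \<otimes>\<^bsub>matrix_product_algebra r w\<^esub> matrix_product_unit r w j' p' q' =
    (if (j, q) = (j', p') then matrix_product_unit r w j p q' else \<zero>\<^bsub>matrix_product_algebra r w\<^esub>)"
proof -
  have entry: "(\<Sum>c = 0..<w i. (if i = j \<and> a = p \<and> c = q then 1 else 0) *
      (if i = j' \<and> c = p' \<and> b = q' then 1 else (0::'k))) =
      (if i = j \<and> i = j' \<and> a = p \<and> b = q' \<and> q = p' then 1 else 0)" for i a b
  proof -
    have "(\<Sum>c = 0..<w i. (if i = j \<and> a = p \<and> c = q then 1 else 0) *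
        (if i = j' \<and> c = p' \<and> b = q' then 1 else (0::'k))) =
      (\<Sum>c = 0..<w i. if c = q then (if i = j \<and> i = j' \<and> a = p \<and> b = q' \<and> q = p' then 1 else 0) else 0)"
      by (rule sum.cong) auto
    then show ?thesis using assms by simp
  qed
  have mat_mult: "mat n n f * mat n n g = mat n n (\<lambda>(a, b). \<Sum>c = 0..<n. f (a, c) * g (c, b))"
    for n and f g :: "nat \<times> nat \<Rightarrow> 'k"
    by (rule eq_matI) (auto simp: scalar_prod_def)
  have "(matrix_product_unit r w j p q :: nat \<Rightarrow> 'k mat) \<otimes>\<^bsub>matrix_product_algebra r w\<^esub> matrix_product_unit r w j' p' q' =
    (\<lambda>i\<in>{..<r}. mat (w i) (w i)
      (\<lambda>(a, b). if i = j \<and> i = j' \<and> a = p \<and> b = q' \<and> q = p' then 1 else 0))"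
    unfolding matrix_product_simps
  proof (rule restrict_ext)
    fix i assume i: "i \<in> {..<r}"
    show "(matrix_product_unit r w j p q i :: 'k mat) * matrix_product_unit r w j' p' q' i =
      mat (w i) (w i) (\<lambda>(a, b). if i = j \<and> i = j' \<and> a = p \<and> b = q' \<and> q = p' then 1 else 0)"
      by (simp only: matrix_product_unit_def restrict_apply'[OF i] mat_mult case_prod_conv entry)
  qed
  then show ?thesis
    by (auto simp: matrix_product_simps matrix_product_unit_def intro!: restrict_ext eq_matI)
qed

text \<open>Expansion of \<open>y\<close> in matrix units, as an induction rule for predicates that are closed under
  addition. Only the multiples with the coefficients of \<open>y\<close> itself have to be checked, so for the
  identity the units off the diagonal occur with coefficient \<open>0\<close>.\<close>

lemma matrix_product_induct [consumes 1, case_names zero add unit]: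
  fixes y :: "nat \<Rightarrow> 'k::field mat"
  assumes y: "y \<in> carrier (matrix_product_algebra r w)"
    and zero: "P \<zero>\<^bsub>matrix_product_algebra r w\<^esub>"
    and add: "\<And>x z. x \<in> carrier (matrix_product_algebra r w) \<Longrightarrow>
      z \<in> carrier (matrix_product_algebra r w) \<Longrightarrow> P x \<Longrightarrow> P z \<Longrightarrow>
      P (x \<oplus>\<^bsub>matrix_product_algebra r w\<^esub> z)"
    and unit: "\<And>j p q. j < r \<Longrightarrow> p < w j \<Longrightarrow> q < w j \<Longrightarrow>
      P (y j $$ (p, q) \<odot>\<^bsub>matrix_product_algebra r w\<^esub> matrix_product_unit r w j p q)"
  shows "P y"
proof -
  interpret B: k_algebra "matrix_product_algebra r w :: ('k, _) module"
    by (rule k_algebra_matrix_product_algebra)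
  \<comment> \<open>The entries of \<open>y\<close> at the positions in \<open>T\<close>, filled up with zeros.\<close>
  define part where "part T = (\<lambda>j\<in>{..<r}. mat (w j) (w j)
    (\<lambda>(a, b). if (j, a, b) \<in> T then y j $$ (a, b) else 0))" for T
  let ?I = "Sigma {..<r} (\<lambda>j. {..<w j} \<times> {..<w j})"
  have carrier_part: "part T \<in> carrier (matrix_product_algebra r w)" for T
    by (auto simp: matrix_product_simps part_def)
  have "P (part T)" if "finite T" "T \<subseteq> ?I" for T
    using that
  proof (induction T rule: finite_induct)
    case empty
    have "part {} = \<zero>\<^bsub>matrix_product_algebra r w\<^esub>"
      by (auto simp: matrix_product_simps part_def intro!: restrict_ext eq_matI)
    then show ?case using zero by simp
  next
    case (insert t T)
    obtain j p q where t: "t = (j, p, q)" by (cases t)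
    have jpq: "j < r" "p < w j" "q < w j" using insert.prems t by auto
    let ?u = "y j $$ (p, q) \<odot>\<^bsub>matrix_product_algebra r w\<^esub> matrix_product_unit r w j p q"
    have "part (insert t T) = ?u \<oplus>\<^bsub>matrix_product_algebra r w\<^esub> part T"
      unfolding matrix_product_simps part_def
    proof (rule restrict_ext)
      fix i assume "i \<in> {..<r}"
      then show "mat (w i) (w i) (\<lambda>(a, b). if (i, a, b) \<in> insert t T then y i $$ (a, b) else 0) =
        (\<lambda>i\<in>{..<r}. y j $$ (p, q) \<cdot>\<^sub>m matrix_product_unit r w j p q i) i +
        (\<lambda>i\<in>{..<r}. mat (w i) (w i) (\<lambda>(a, b). if (i, a, b) \<in> T then y i $$ (a, b) else 0)) i"
        using insert.hyps(2) t by (intro eq_matI) (auto simp: matrix_product_unit_def)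
    qed
    moreover have "?u \<in> carrier (matrix_product_algebra r w)"
      by (rule B.smult_closed) (simp_all add: matrix_product_unit_carrier)
    moreover have "P (part T)" using insert.prems by (intro insert.IH) simp
    ultimately show ?case using carrier_part unit[OF jpq] by (simp add: add)
  qed
  then have "P (part ?I)" by simp
  moreover have "part ?I = y"
  proof (rule PiE_ext)
    show "part ?I \<in> (\<Pi>\<^sub>E j\<in>{..<r}. carrier_mat (w j) (w j))" "y \<in> (\<Pi>\<^sub>E j\<in>{..<r}. carrier_mat (w j) (w j))"
      using carrier_part y by (simp_all add: matrix_product_simps)
    fix j assume j: "j \<in> {..<r}"
    then have "y j \<in> carrier_mat (w j) (w j)" using y by (auto simp: matrix_product_simps)
    then show "part ?I j = y j" using j by (intro eq_matI) (simp_all add: part_def)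
  qed
  ultimately show ?thesis by simp
qed

lemma left_module_pullback:
  assumes "left_module A V \<rho>" and B: "k_algebra B"
    and h: "h \<in> Ring.ring_hom B A" "h \<in> module_hom class_ring B A"
  shows "left_module B V (\<lambda>b. \<rho> (h b))"
proof -
  interpret A: left_module A V \<rho> by fact
  interpret B: k_algebra B by fact
  have hc: "h b \<in> carrier A" if "b \<in> carrier B" for b
    using h that by (simp add: ring_hom_closed)
  show ?thesis
    by (intro left_module.intro B A.vectorspace_axioms left_module_axioms.intro)
      (use h in \<open>simp_all add: hc ring_hom_add ring_hom_mult ring_hom_one A.act_linear A.act_add
        A.act_mult A.act_one A.act_smult LinearCombinations.module_hom_smult\<close>)
qed

lemma (in left_module) act_zero: "v \<in> carrier V \<Longrightarrow> \<rho> \<zero>\<^bsub>A\<^esub> v = \<zero>\<^bsub>V\<^esub>"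
  using act_smult[of "\<zero>\<^bsub>A\<^esub>" v 0] hom_carrier[OF act_linear]
    lmult_0[of "\<rho> \<zero>\<^bsub>A\<^esub> v"] by simp

context
  fixes r :: nat and w :: "nat \<Rightarrow> nat" and V :: "('k::field, 'v) module"
    and \<sigma> :: "(nat \<Rightarrow> 'k mat) \<Rightarrow> 'v \<Rightarrow> 'v"
  assumes module: "left_module (matrix_product_algebra r w) V \<sigma>"
    and pos: "\<And>j. j < r \<Longrightarrow> 0 < w j"
begin

interpretation left_module "matrix_product_algebra r w" V \<sigma> by (rule module)

lemma act_scaled_unit:
  "v \<in> carrier V \<Longrightarrow> \<sigma> (c \<odot>\<^bsub>matrix_product_algebra r w\<^esub> matrix_product_unit r w j p q) v =
    c \<odot>\<^bsub>V\<^esub> \<sigma> (matrix_product_unit r w j p q) v"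
  by (rule act_smult[OF matrix_product_unit_carrier])

text \<open>Completeness comes from expanding the identity of the algebra, which acts as the identity
  map.\<close>

lemma matrix_unit_action_of_module:
  "matrix_unit_action class_ring V r w (\<lambda>j p q. \<sigma> (matrix_product_unit r w j p q))"
proof (intro matrix_unit_action.intro vectorspace_axioms matrix_unit_action_axioms.intro, goal_cases)
  case (1 j)
  then show ?case by (rule pos)
next
  case (2 j p q)
  show ?case by (rule act_linear[OF matrix_product_unit_carrier])
next
  case (3 j p q q' v)
  then show ?case
    by (simp add: act_mult[OF matrix_product_unit_carrier matrix_product_unit_carrier, symmetric]
        matrix_product_unit_mult)
next
  case (4 j p q j' p' q' v)
  then show ?case
    by (subst act_mult[OF matrix_product_unit_carrier matrix_product_unit_carrier, symmetric])
      (simp_all add: matrix_product_unit_mult act_zero del: prod.inject)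
next
  case (5 v)
  let ?X = "{\<sigma> (matrix_product_unit r w j p p) v | j p. j < r \<and> p < w j}"
  have E: "\<sigma> (matrix_product_unit r w j p q) v \<in> carrier V" for j p q
    using hom_carrier[OF act_linear[OF matrix_product_unit_carrier] 5] .
  then have X: "?X \<subseteq> carrier V" by auto
  have "\<one>\<^bsub>matrix_product_algebra r w\<^esub> \<in> carrier (matrix_product_algebra r w :: ('k, _) module)"
    by (simp add: matrix_product_simps)
  then have "\<sigma> \<one>\<^bsub>matrix_product_algebra r w\<^esub> v \<in> span ?X"
  proof (induction rule: matrix_product_induct)
    case zero
    then show ?case by (simp add: act_zero 5 span_zero)
  next
    case (add x z)
    then show ?case by (simp add: act_add 5 span_add1[OF X])
  next
    case (unit j p q)
    have "\<sigma> (matrix_product_unit r w j p p) v \<in> span ?X"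
      using unit by (intro span_mem[OF X]) auto
    moreover have "(\<one>\<^bsub>matrix_product_algebra r w\<^esub> :: nat \<Rightarrow> 'k mat) j $$ (p, q) = (if p = q then 1 else 0)"
      using unit by (simp add: matrix_product_simps)
    ultimately show ?case
      using lmult_0[OF E[of j p q]] smult_one[OF E[of j p q]]
      by (auto simp: act_scaled_unit[OF 5] span_zero)
  qed
  then show ?case by (simp add: act_one 5)
qed

lemma submodule_iff_stable:
  assumes N: "subspace class_ring N V"
  shows "matrix_unit_action.stable r w (\<lambda>j p q. \<sigma> (matrix_product_unit r w j p q)) N \<longleftrightarrow>
    (\<forall>y\<in>carrier (matrix_product_algebra r w). \<forall>v\<in>N. \<sigma> y v \<in> N)"
  unfolding matrix_unit_action.stable_def[OF matrix_unit_action_of_module]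
proof (intro iffI ballI)
  fix y :: "nat \<Rightarrow> 'k mat" and v assume st: "\<forall>j<r. \<forall>p<w j. \<forall>q<w j. \<sigma> (matrix_product_unit r w j p q) ` N \<subseteq> N"
    and y: "y \<in> carrier (matrix_product_algebra r w)" and v: "v \<in> N"
  note N' = subspace_elim[OF N]
  have vV: "v \<in> carrier V" using v N' by auto
  show "\<sigma> y v \<in> N"
    using y
  proof (induction rule: matrix_product_induct)
    case zero
    then show ?case by (simp add: act_zero vV N')
  next
    case (add x z)
    then show ?case by (simp add: act_add vV N')
  next
    case (unit j p q)
    then have "\<sigma> (matrix_product_unit r w j p q) v \<in> N" using st v by blast
    then show ?case by (simp add: act_scaled_unit vV N')
  qed
qed (auto simp: matrix_product_unit_carrier)

end

section \<open>Submodules over a free product\<close>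

lemma sum_single_lookup:
  "(\<Sum>u\<in>Poly_Mapping.keys f. Poly_Mapping.single u (Poly_Mapping.lookup f u)) = f"
  by (rule poly_mapping_eqI) (auto simp: lookup_sum lookup_single when_def in_keys_iff)

lemma single_Word_Cons:
  "Poly_Mapping.single (Word (x # xs)) (1::'k::field) = gen x * Poly_Mapping.single (Word xs) 1"
  by (simp add: gen_def mult_single plus_free_monoid_def)

text \<open>The polynomials whose classes map \<open>N\<close> to itself contain the generators and are closed under
  addition, multiplication and scalars, hence contain every word and every polynomial.\<close>

lemma left_submodule_free_product_iff:
  fixes B :: "'i \<Rightarrow> ('k::field, 'b) module"
  assumes B: "\<And>i. i \<in> I \<Longrightarrow> k_algebra (B i)" and "left_module (free_product I B) V \<rho>"
  shows "left_submodule (free_product I B) V \<rho> N \<longleftrightarrow> subspace class_ring N V \<and>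
    (\<forall>i\<in>I. \<forall>x\<in>carrier (B i). \<forall>v\<in>N. \<rho> (free_product_inj I B i x) v \<in> N)"
proof -
  interpret left_module "free_product I B" V \<rho> by fact
  let ?P = "free_product I B" and ?F = "free_algebra (free_product_gens I B)"
  let ?cl = "free_product_class I B"
  note simps = free_product_carrier[OF B] free_product_ops[OF B] free_product_one_zero[OF B]
  have inj_closed: "free_product_inj I B i x \<in> carrier ?P" if "i \<in> I" "x \<in> carrier (B i)" for i x
    using free_product_inj_hom[of I B i, OF B that(1)] that(2) by (auto simp: ring_hom_closed)
  have "\<forall>v\<in>N. \<rho> a v \<in> N"
    if N: "subspace class_ring N V" and a: "a \<in> carrier ?P"
      and st: "\<And>i x v. i \<in> I \<Longrightarrow> x \<in> carrier (B i) \<Longrightarrow> v \<in> N \<Longrightarrow> \<rho> (free_product_inj I B i x) v \<in> N"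
    for a
  proof -
    note N' = subspace_elim[OF N]
    \<comment> \<open>The noncommutative polynomials whose classes map \<open>N\<close> to itself.\<close>
    let ?keeps = "\<lambda>f. f \<in> carrier ?F \<and> (\<forall>v\<in>N. \<rho> (?cl f) v \<in> N)"
    have cl_closed: "?cl f \<in> carrier ?P" if "f \<in> carrier ?F" for f
      using that by (simp add: simps del: free_algebra_simps)
    have NV: "v \<in> carrier V" if "v \<in> N" for v using that N' by auto
    have add: "?keeps (f + g)" if "?keeps f" "?keeps g" for f g
      using that free_algebra_add_closed[of f _ g] act_add[OF cl_closed cl_closed NV, of f g] N'
      by (simp add: free_product_ops[OF B] del: free_algebra_simps)
    have mult: "?keeps (f * g)" if "?keeps f" "?keeps g" for f g
      using that free_algebra_mult_closed[of f _ g] act_mult[OF cl_closed cl_closed NV, of f g]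
      by (simp add: free_product_ops[OF B] del: free_algebra_simps)
    have one: "?keeps 1"
      using act_one NV free_algebra_one_closed
      by (simp add: free_product_one_zero(1)[OF B, symmetric] del: free_algebra_simps)
    have zero: "?keeps 0"
      using act_zero NV N'(2)
      by (simp add: free_product_one_zero(2)[OF B, symmetric])
    have scale: "?keeps (Poly_Mapping.single 0 c * f)" if f: "?keeps f" for f c
    proof -
      note fc = conjunct1[OF f]
      have "\<rho> (?cl (Poly_Mapping.single 0 c * f)) v = c \<odot>\<^bsub>V\<^esub> \<rho> (?cl f) v" if "v \<in> N" for v
        using act_smult[OF cl_closed[OF fc] NV[OF that], of c]
          free_product_ops(3)[where I = I and B = B and f = f and g = f and c = c, OF B fc fc] by simp
      then show ?thesis
        using f N'(4) free_algebra_mult_closed[OF free_algebra_scalar_closed fc] by simp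
    qed
    have gen: "?keeps (gen x)" if x: "x \<in> free_product_gens I B" for x
    proof -
      obtain i b where "x = (i, b)" "i \<in> I" "b \<in> carrier (B i)"
        using x by (auto simp: free_product_gens_def)
      then show ?thesis
        using st free_algebra_gen_closed[OF x] by (auto simp: free_product_inj_def)
    qed
    have word: "?keeps (Poly_Mapping.single (Word xs) 1)" if "set xs \<subseteq> free_product_gens I B" for xs
      using that
    proof (induction xs)
      case Nil
      have "Poly_Mapping.single (Word []) 1 = (1 :: ('i \<times> 'b) free_monoid \<Rightarrow>\<^sub>0 'k)"
        by (simp flip: zero_free_monoid_def)
      then show ?case using one by simp
    next
      case (Cons x xs)
      then show ?case unfolding single_Word_Cons by (intro mult gen) auto
    qed
    have keeps: "?keeps f" if f: "f \<in> carrier ?F" for f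
    proof -
      have mono: "?keeps (Poly_Mapping.single u (Poly_Mapping.lookup f u))"
        if u: "u \<in> Poly_Mapping.keys f" for u
      proof -
        obtain xs where xs: "u = Word xs" by (cases u)
        have "\<forall>u\<in>Poly_Mapping.keys f. set (letters u) \<subseteq> free_product_gens I B" using f by simp
        from bspec[OF this u] have "set xs \<subseteq> free_product_gens I B" by (simp add: xs)
        then have k: "?keeps (Poly_Mapping.single 0 (Poly_Mapping.lookup f u) * Poly_Mapping.single (Word xs) 1)"
          by (intro scale word)
        have eq: "Poly_Mapping.single 0 (Poly_Mapping.lookup f u) * Poly_Mapping.single (Word xs) 1 =
            Poly_Mapping.single u (Poly_Mapping.lookup f u)"
          unfolding xs mult_single by simp
        show ?thesis using k unfolding eq .
      qed
      have "?keeps (\<Sum>u\<in>K. Poly_Mapping.single u (Poly_Mapping.lookup f u))"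
        if "finite K" "K \<subseteq> Poly_Mapping.keys f" for K
        using that
      proof (induction K rule: finite_induct)
        case empty
        show ?case using zero by simp
      next
        case (insert u K)
        have "?keeps (\<Sum>u\<in>K. Poly_Mapping.single u (Poly_Mapping.lookup f u))"
          by (rule insert.IH) (use insert.prems in blast)
        moreover have "?keeps (Poly_Mapping.single u (Poly_Mapping.lookup f u))"
          by (rule mono) (use insert.prems in blast)
        ultimately show ?case unfolding sum.insert[OF insert.hyps] by (intro add)
      qed
      from this[OF finite_keys subset_refl] show ?thesis unfolding sum_single_lookup .
    qed
    have "carrier ?P = ?cl ` carrier ?F" by (rule free_product_carrier) (rule B)
    then obtain f where "f \<in> carrier ?F" "a = ?cl f" using a by blast
    then show ?thesis using keeps by blast
  qed
  then show ?thesis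
    using inj_closed unfolding left_submodule_def by blast
qed

section \<open>Stable representations and simple modules\<close>

text \<open>The action of the \<open>i\<close>-th factor is pulled back along \<open>\<phi> i\<close> to the product of matrix algebras,
  where the matrix units are available. As \<open>\<phi> i\<close> is surjective, closure under the matrix units is
  closure under the factor.\<close>

theorem proposition3p5:
  fixes m :: nat
    and A :: "nat \<Rightarrow> ('k::alg_closed_field, 'b) module"
    and r :: "nat \<Rightarrow> nat"
    and w :: "nat \<Rightarrow> nat \<Rightarrow> nat"
    and \<phi> :: "nat \<Rightarrow> (nat \<Rightarrow> 'k mat) \<Rightarrow> 'b"
    and M :: "('k, 'v) module"
    and \<rho> :: "((nat \<times> 'b) free_monoid \<Rightarrow>\<^sub>0 'k) set \<Rightarrow> 'v \<Rightarrow> 'v"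
  assumes "m \<ge> 1"
    and "\<And>i. i < m \<Longrightarrow> k_algebra (A i)"
    and "\<And>i. i < m \<Longrightarrow> vectorspace.fin_dim class_ring (A i)"
    and "\<And>i. i < m \<Longrightarrow> semisimple_algebra (A i)"
    and "\<And>i. i < m \<Longrightarrow> vectorspace.dim class_ring (A i) \<noteq> 1"
    and "\<And>i j. i < m \<Longrightarrow> j < r i \<Longrightarrow> w i j \<ge> 1"
    and "\<And>i. i < m \<Longrightarrow> \<phi> i \<in> algebra_iso (matrix_product_algebra (r i) (w i)) (A i)"
    and "in_rep (free_product {..<m} A) M \<rho>"
  shows "theta_stable (Gamma m r w) (theta m w) (F_obj (matrix_unit m A r w \<phi>) M \<rho>)
    \<longleftrightarrow> simple_module (free_product {..<m} A) M \<rho>"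
proof -
  let ?P = "free_product {..<m} A"
  let ?E = "matrix_unit m A r w \<phi>"
  have A: "k_algebra (A i)" if "i \<in> {..<m}" for i using assms(2) that by simp
  have mod: "left_module ?P M \<rho>" and fin: "vectorspace.fin_dim class_ring M"
    using assms(8) by (simp_all add: in_rep_def)
  interpret P: left_module ?P M \<rho> by (rule mod)
  \<comment> \<open>The action of the product of matrix algebras through the \<open>i\<close>-th factor.\<close>
  define \<sigma> where "\<sigma> i y = \<rho> (free_product_inj {..<m} A i (\<phi> i y))" for i y
  have \<phi>: "\<phi> i \<in> Ring.ring_hom (matrix_product_algebra (r i) (w i)) (A i)"
    "\<phi> i \<in> module_hom class_ring (matrix_product_algebra (r i) (w i)) (A i)"
    "\<phi> i ` carrier (matrix_product_algebra (r i) (w i)) = carrier (A i)" if "i < m" for i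
    using assms(7)[OF that] by (auto simp: algebra_iso_def ring_iso_def bij_betw_def)
  have \<sigma>: "left_module (matrix_product_algebra (r i) (w i)) M (\<sigma> i)" if "i < m" for i
  proof -
    have "left_module (A i) M (\<lambda>x. \<rho> (free_product_inj {..<m} A i x))"
      using free_product_inj_hom[of "{..<m}" A i, OF A] that
      by (intro left_module_pullback[OF mod] A) auto
    from left_module_pullback[OF this k_algebra_matrix_product_algebra \<phi>(1,2)] that
    show ?thesis by (simp add: \<sigma>_def[abs_def])
  qed
  have pos: "0 < w i j" if "i < m" "j < r i" for i j using assms(6)[OF that] by simp
  have unit: "(\<lambda>j p q. \<rho> (?E i j p q)) = (\<lambda>j p q. \<sigma> i (matrix_product_unit (r i) (w i) j p q))" for i
    by (simp add: \<sigma>_def matrix_unit_def)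
  interpret matrix_unit_actions M m r w ?E \<rho>
    by (intro matrix_unit_actions.intro P.vectorspace_axioms matrix_unit_actions_axioms.intro fin)
      (simp only: unit matrix_unit_action_of_module[OF \<sigma> pos])
  have "left_submodule ?P M \<rho> N \<longleftrightarrow> subspace class_ring N M \<and> (\<forall>i<m. stable_at i N)" for N
  proof -
    have "stable_at i N \<longleftrightarrow> (\<forall>x\<in>carrier (A i). \<forall>v\<in>N. \<rho> (free_product_inj {..<m} A i x) v \<in> N)"
      if N: "subspace class_ring N M" and i: "i < m" for i
    proof -
      have "stable_at i N \<longleftrightarrow> (\<forall>y\<in>carrier (matrix_product_algebra (r i) (w i)). \<forall>v\<in>N. \<sigma> i y v \<in> N)"
        unfolding unit by (rule submodule_iff_stable[OF \<sigma>[OF i] pos[OF i] N])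
      then show ?thesis by (simp add: \<phi>(3)[OF i, symmetric] \<sigma>_def)
    qed
    then show ?thesis
      using left_submodule_free_product_iff[of "{..<m}" A, OF A mod, of N] by auto
  qed
  then show ?thesis
    unfolding theta_stable_FM_iff simple_module_def by simp
qed

end
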